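(* Let $d\ge1$. There is a constant $c>0$ depending only on $d$ such that for every $N\ge1$ and every set $Z=\{z_1,\dots,z_N\}\subset\mathbb{S}^d$, $$D_{L^2,\mathrm{cap}}(Z)\;\ge\; c\,N^{-\frac12-\frac1{2d}}\left(\frac1N\sum_{i,j=1}^{N}\frac{\log\bigl(2+N^{1/d}\|z_i-z_j\|\bigr)}{\bigl(1+N^{1/d}\|z_i-z_j\|\bigr)^{d+1}}\right)^{1/2}.$$
   Context: $\mathbb{S}^d$ is the unit sphere in $\mathbb{R}^{d+1}$ with normalized surface measure $\sigma$; $\|\cdot\|$ is the Euclidean norm. For $x\in\mathbb{S}^d$ and $\tau\in[-1,1]$, $C(x,\tau)=\{y\in\mathbb{S}^d: x\cdot y\ge\tau\}$ is a spherical cap. The $L^2$-spherical cap discrepancy of $Z$ is defined by $$D_{L^2,\mathrm{cap}}^2(Z)=\int_{-1}^{1}\int_{\mathbb{S}^d}\Bigl|\frac1N\sum_{j=1}^N\mathbf{1}_{C(x,\tau)}(z_j)-\sigma\bigl(C(x,\tau)\bigr)\Bigr|^2\,d\sigma(x)\,d\tau .$$ *)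

theory Defs
  imports "HOL-Analysis.Analysis"
begin

text \<open>Normalized surface measure on the unit sphere of real^'n, realised as the
cone measure: push-forward of the normalized Lebesgue measure on the unit ball
under radial projection x \<mapsto> x / norm x (the origin is a null set).\<close>
definition sphere_measure :: "(real^'n) measure" where
  "sphere_measure = distr (uniform_measure lborel (ball 0 1)) borel (\<lambda>x. x /\<^sub>R norm x)"

definition spherical_cap :: "real^'n \<Rightarrow> real \<Rightarrow> (real^'n) set" where
  "spherical_cap x \<tau> = {y \<in> sphere 0 1. x \<bullet> y \<ge> \<tau>}"

definition cap_discrepancy_sq :: "(real^'n) set \<Rightarrow> real" where
  "cap_discrepancy_sq Z =
     (\<integral>\<tau>\<in>{-1..1}. (\<integral>x. \<bar>real (card {z \<in> Z. z \<in> spherical_cap x \<tau>}) / real (card Z)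
          - measure sphere_measure (spherical_cap x \<tau>)\<bar>\<^sup>2 \<partial>sphere_measure) \<partial>lborel)"

definition cap_discrepancy :: "(real^'n) set \<Rightarrow> real" where
  "cap_discrepancy Z = sqrt (cap_discrepancy_sq Z)"

end

theory Submission
  imports Defs "HOL-Probability.Probability"
begin

text \<open>
  Let \<mu> be the difference of the empirical measure of Z and the surface measure \<sigma>, and
  let E(k) denote the double integral of a kernel k against \<mu> \<times> \<mu>. Expanding the square in the
  discrepancy and using rotation invariance gives Stolarsky's identity
  D^2 = - (c/2) E(|y - z|), where c is the mean of |x \<bullet> e| over the sphere.
  Writing \<kappa> |r| as the integral of 1 - exp(-r^2/s^2) over s > 0 turns this into
  \<kappa> D^2 = (c/2) times the integral over s > 0 of E(K_s) with K_s = exp(-|y - z|^2/s^2). Each E(K_s) is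
  nonnegative, as Gaussians are positive definite, so the integrand may be multiplied by the weight
  (s0/s)^(d + 3/2) on s \<ge> s0, and 0 elsewhere, where s0 = a N^(-1/d). Since the integral of K_s(y, .)
  against \<sigma> is O(s^d), for small a the diagonal terms of the empirical double sum beat the
  contribution of \<sigma>, and half of the double sum survives. The weighted integral of K_s is at least
  a multiple of s0 (1 + |y - z|/s0)^(-d - 1/2), which decays more slowly than the required
  log(2 + R) / (1 + R)^(d + 1), R = N^(1/d) |y - z|.
\<close>

subsection \<open>Rotation invariance of the surface measure\<close>

lemma nn_integral_lborel_translation:
  fixes a :: "'a::euclidean_space"
  assumes [measurable]: "g \<in> borel_measurable borel"
  shows "(\<integral>\<^sup>+x. g (a + x) \<partial>lborel) = (\<integral>\<^sup>+x. g x \<partial>lborel)"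
proof -
  have "(\<integral>\<^sup>+x. g x \<partial>lborel) = (\<integral>\<^sup>+x. g x \<partial>distr lborel borel ((+) a))"
    by (simp add: lborel_distr_plus)
  then show ?thesis by (simp add: nn_integral_distr)
qed

lemma emeasure_unit_ball:
  "emeasure lborel (ball (0::real^'n) 1) \<noteq> 0" "emeasure lborel (ball (0::real^'n) 1) \<noteq> \<infinity>"
proof -
  show "emeasure lborel (ball (0::real^'n) 1) \<noteq> 0"
    using content_ball_pos[of 1 "0::real^'n"] by (auto simp: measure_def)
  show "emeasure lborel (ball (0::real^'n) 1) \<noteq> \<infinity>"
    using emeasure_lborel_ball_finite[of "0::real^'n" 1] by auto
qed

lemma borel_measurable_orthogonal_transformation:
  fixes f :: "real^'n \<Rightarrow> real^'n"
  assumes "orthogonal_transformation f"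
  shows "f \<in> borel_measurable borel"
  using assms
  by (intro borel_measurable_continuous_onI linear_continuous_on linear_conv_bounded_linear[THEN iffD1]
      orthogonal_transformation_linear)

text \<open>
  The library's \<^verbatim>\<open>measure_orthogonal_image\<close> needs a well-ordered index type. Instead, as in the uniqueness
  proof for Haar measure, multiply by the integral of the rotation invariant indicator h of the
  ball and translate under Fubini.
\<close>
lemma nn_integral_lborel_orthogonal:
  fixes f :: "real^'n \<Rightarrow> real^'n" and g :: "real^'n \<Rightarrow> ennreal"
  assumes f: "orthogonal_transformation f" and [measurable]: "g \<in> borel_measurable borel"
  shows "(\<integral>\<^sup>+x. g (f x) \<partial>lborel) = (\<integral>\<^sup>+x. g x \<partial>lborel)"
proof -
  have [measurable]: "f \<in> borel_measurable borel" by (rule borel_measurable_orthogonal_transformation[OF f])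
  have lin: "linear f" using f by (simp add: orthogonal_transformation_linear)
  have nf: "norm (f x) = norm x" for x using f by (simp add: orthogonal_transformation)
  obtain f' where f': "\<And>x. f (f' x) = x"
    using f orthogonal_transformation_bij by (metis bij_inv_eq_iff)
  let ?V = "emeasure lborel (ball (0::real^'n) 1)"
  define h :: "real^'n \<Rightarrow> ennreal" where "h = indicator (ball 0 1)"
  have [measurable]: "h \<in> borel_measurable borel"
    unfolding h_def by (rule borel_measurable_indicator) simp
  have hV: "(\<integral>\<^sup>+y. h (y - a) \<partial>lborel) = ?V" "(\<integral>\<^sup>+y. h y \<partial>lborel) = ?V" for a
    using nn_integral_lborel_translation[of h "-a", OF \<open>h \<in> _\<close>] by (simp_all add: h_def)
  have "(\<integral>\<^sup>+x. g (f x) \<partial>lborel) * ?V = (\<integral>\<^sup>+x. g (f x) * (\<integral>\<^sup>+y. h (y - f x) \<partial>lborel) \<partial>lborel)"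
    by (simp add: hV nn_integral_multc)
  also have "\<dots> = (\<integral>\<^sup>+x. \<integral>\<^sup>+y. g (f x) * h (y - f x) \<partial>lborel \<partial>lborel)"
    by (simp add: nn_integral_cmult)
  also have "\<dots> = (\<integral>\<^sup>+y. \<integral>\<^sup>+x. g (f x) * h (y - f x) \<partial>lborel \<partial>lborel)"
    by (rule lborel_pair.Fubini') measurable
  \<comment> \<open>Translating x by \<open>f' y\<close> turns \<open>f x\<close> into
    \<open>f x + y\<close>. The argument of \<open>h\<close> becomes \<open>- f x\<close>, and
    \<open>h\<close> depends only on the norm, which \<open>f\<close> preserves.\<close>
  also have "\<dots> = (\<integral>\<^sup>+y. \<integral>\<^sup>+x. g (f x + y) * h x \<partial>lborel \<partial>lborel)"
  proof (rule nn_integral_cong)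
    fix y
    have "(\<integral>\<^sup>+x. g (f x) * h (y - f x) \<partial>lborel) = (\<integral>\<^sup>+x. g (f (f' y + x)) * h (y - f (f' y + x)) \<partial>lborel)"
      by (rule nn_integral_lborel_translation[symmetric]) simp
    moreover have "f (f' y + x) = f x + y" for x by (simp add: linear_add[OF lin] f')
    moreover have "h (y - (f x + y)) = h x" for x by (simp add: h_def indicator_def nf)
    ultimately show "(\<integral>\<^sup>+x. g (f x) * h (y - f x) \<partial>lborel) = (\<integral>\<^sup>+x. g (f x + y) * h x \<partial>lborel)"
      by (simp only:)
  qed
  also have "\<dots> = (\<integral>\<^sup>+x. \<integral>\<^sup>+y. g (f x + y) * h x \<partial>lborel \<partial>lborel)"
    by (rule lborel_pair.Fubini') measurable
  also have "\<dots> = (\<integral>\<^sup>+x. (\<integral>\<^sup>+y. g (f x + y) \<partial>lborel) * h x \<partial>lborel)"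
    by (simp add: nn_integral_multc)
  also have "\<dots> = (\<integral>\<^sup>+y. g y \<partial>lborel) * ?V"
    by (simp only: nn_integral_lborel_translation[OF assms(2)]) (simp add: nn_integral_cmult hV)
  \<comment> \<open>The common factor \<open>?V\<close> is nonzero and finite, so it cancels in
    \<open>ennreal\<close>.\<close>
  finally show ?thesis
    using emeasure_unit_ball[where 'n='n] by (metis infinity_ennreal_def mult_divide_eq_ennreal)
qed

section \<open>The surface measure as a cone measure\<close>

lemma sphere_measure_normalize_measurable [measurable]:
  "(\<lambda>x::real^'n. x /\<^sub>R norm x) \<in> borel_measurable borel"
  by measurable

lemma sets_sphere_measure [simp, measurable_cong]: "sets sphere_measure = sets borel"
  and space_sphere_measure [simp]: "space sphere_measure = UNIV"
  by (simp_all add: sphere_measure_def)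

lemma prob_space_sphere_measure: "prob_space (sphere_measure :: (real^'n) measure)"
  unfolding sphere_measure_def
  by (intro prob_space.prob_space_distr prob_space_uniform_measure)
     (use emeasure_unit_ball in auto)

lemma nn_integral_sphere_measure:
  fixes g :: "real^'n \<Rightarrow> ennreal"
  assumes [measurable]: "g \<in> borel_measurable borel"
  shows "(\<integral>\<^sup>+x. g x \<partial>sphere_measure) =
    (\<integral>\<^sup>+x. g (x /\<^sub>R norm x) * indicator (ball 0 1) x \<partial>lborel) / emeasure lborel (ball (0::real^'n) 1)"
  unfolding sphere_measure_def
  by (subst nn_integral_distr) (auto simp: nn_integral_uniform_measure)

text \<open>Radial projection misses the sphere only at the origin, where
  \<open>inverse 0 = 0\<close> gives the value 0, and a single point is a null set.\<close>

lemma AE_sphere_measure: "AE x in (sphere_measure :: (real^'n) measure). x \<in> sphere 0 1"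
  unfolding sphere_measure_def
proof (subst AE_distr_iff)
  have "AE x in lborel. x \<noteq> (0::real^'n)" by (rule AE_lborel_singleton)
  then show "AE x in uniform_measure lborel (ball 0 1). x /\<^sub>R norm x \<in> sphere (0::real^'n) 1"
    by (intro AE_uniform_measureI) auto
qed simp_all

text \<open>An orthogonal map commutes with radial projection and preserves the unit ball, so the
  invariance of Lebesgue measure passes to the push-forward.\<close>

lemma distr_sphere_measure_orthogonal:
  fixes f :: "real^'n \<Rightarrow> real^'n"
  assumes f: "orthogonal_transformation f"
  shows "distr sphere_measure borel f = sphere_measure"
proof (rule measure_eqI)
  have lin: "linear f" using f by (simp add: orthogonal_transformation_linear)
  have fm [measurable]: "f \<in> borel_measurable borel" by (rule borel_measurable_orthogonal_transformation[OF f])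
  have nf: "norm (f x) = norm x" for x using f by (simp add: orthogonal_transformation)
  have ff: "f (x /\<^sub>R norm x) = f x /\<^sub>R norm (f x)" for x
    by (simp add: linear_scale[OF lin] nf)
  fix A assume "A \<in> sets (distr (sphere_measure :: (real^'n) measure) borel f)"
  then have [measurable]: "A \<in> sets borel" by simp
  have "(\<integral>\<^sup>+x. indicator A (f (x /\<^sub>R norm x)) * indicator (ball 0 1) x \<partial>lborel)
     = (\<integral>\<^sup>+x. indicator A (f x /\<^sub>R norm (f x)) * indicator (ball 0 1) (f x) \<partial>lborel)"
    by (auto simp: ff nf indicator_def intro!: nn_integral_cong)
  also have "\<dots> = (\<integral>\<^sup>+x. indicator A (x /\<^sub>R norm x) * indicator (ball 0 1) x \<partial>lborel)"
    by (rule nn_integral_lborel_orthogonal[OF f]) (intro borel_measurable_times_ennreal borel_measurable_indicator measurable_compose[OF _ borel_measurable_indicator[of A borel]]; simp)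
  finally have "(\<integral>\<^sup>+x. indicator A (f x) \<partial>sphere_measure) = (\<integral>\<^sup>+x. indicator A x \<partial>(sphere_measure::(real^'n) measure))"
    by (subst (1 2) nn_integral_sphere_measure) simp_all
  moreover have "(\<integral>\<^sup>+x. indicator A (f x) \<partial>sphere_measure) = (\<integral>\<^sup>+x. indicator A x \<partial>distr (sphere_measure :: (real^'n) measure) borel f)"
    by (subst nn_integral_distr) auto
  ultimately show "emeasure (distr sphere_measure borel f) A = emeasure sphere_measure A"
    by simp
qed simp

lemma integrable_sphere_measure:
  fixes g :: "real^'n \<Rightarrow> real"
  assumes "g \<in> borel_measurable borel" "\<And>x. norm x = 1 \<Longrightarrow> \<bar>g x\<bar> \<le> B"
  shows "integrable sphere_measure g"
proof -
  interpret prob_space "sphere_measure :: (real^'n) measure" by (rule prob_space_sphere_measure)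
  show ?thesis
    by (rule integrable_const_bound[of _ B]) (use assms AE_sphere_measure in auto)
qed

lemma integral_sphere_measure_orthogonal:
  fixes f :: "real^'n \<Rightarrow> real^'n" and g :: "real^'n \<Rightarrow> real"
  assumes f: "orthogonal_transformation f" and [measurable]: "g \<in> borel_measurable borel"
  shows "(\<integral>x. g (f x) \<partial>sphere_measure) = (\<integral>x. g x \<partial>sphere_measure)"
proof -
  have lin: "linear f" using f by (simp add: orthogonal_transformation_linear)
  have fm [measurable]: "f \<in> borel_measurable borel" by (rule borel_measurable_orthogonal_transformation[OF f])
  have "(\<integral>x. g (f x) \<partial>sphere_measure) = (\<integral>x. g x \<partial>distr (sphere_measure :: (real^'n) measure) borel f)"
    by (subst integral_distr) auto
  then show ?thesis by (simp add: distr_sphere_measure_orthogonal[OF f])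
qed

text \<open>The antipodal map preserves the measure and flips the sign of the integrand.\<close>

lemma integral_sphere_measure_inner:
  "(\<integral>x. x \<bullet> v \<partial>sphere_measure) = (0::real)" for v :: "real^'n"
proof -
  have "(\<integral>x. (-x) \<bullet> v \<partial>sphere_measure) = (\<integral>x. x \<bullet> v \<partial>sphere_measure)"
    by (rule integral_sphere_measure_orthogonal[of uminus "\<lambda>x. x \<bullet> v"])
       (auto simp: orthogonal_transformation_neg)
  then show ?thesis by simp
qed

text \<open>Some rotation carries a multiple of a fixed axis to \<open>v\<close>, so by invariance
  only the length of \<open>v\<close> matters, and it enters linearly.\<close>

lemma integral_sphere_measure_abs_inner:
  obtains c :: real where "c > 0" "\<And>v::real^'n. (\<integral>x. \<bar>x \<bullet> v\<bar> \<partial>sphere_measure) = c * norm v"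
proof -
  interpret prob_space "sphere_measure :: (real^'n) measure" by (rule prob_space_sphere_measure)
  \<comment> \<open>\<open>undefined\<close> serves as an arbitrary index; it only selects some unit
    coordinate vector.\<close>
  define c where "c = (\<integral>x. \<bar>x \<bullet> (axis undefined 1 :: real^'n)\<bar> \<partial>sphere_measure)"
  have eq: "(\<integral>x. \<bar>x \<bullet> v\<bar> \<partial>sphere_measure) = c * norm v" for v :: "real^'n"
  proof -
    have "norm v = norm (norm v *\<^sub>R (axis undefined 1 :: real^'n))" by simp
    from orthogonal_transformation_exists[OF this[symmetric]]
    obtain f where f: "orthogonal_transformation f" and fv: "f (norm v *\<^sub>R (axis undefined 1 :: real^'n)) = v" .
    have "(\<integral>x. \<bar>x \<bullet> v\<bar> \<partial>sphere_measure) = (\<integral>x. \<bar>f x \<bullet> v\<bar> \<partial>sphere_measure)"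
      by (rule integral_sphere_measure_orthogonal[OF f, symmetric]) auto
    also have "\<dots> = (\<integral>x. norm v * \<bar>x \<bullet> (axis undefined 1 :: real^'n)\<bar> \<partial>sphere_measure)"
    proof (rule Bochner_Integration.integral_cong)
      fix x
      have "f x \<bullet> v = x \<bullet> (norm v *\<^sub>R (axis undefined 1 :: real^'n))"
        using f unfolding orthogonal_transformation_def by (metis fv)
      then show "\<bar>f x \<bullet> v\<bar> = norm v * \<bar>x \<bullet> (axis undefined 1 :: real^'n)\<bar>" by (simp add: abs_mult)
    qed simp
    finally show ?thesis by (simp add: c_def)
  qed
  have int: "integrable sphere_measure (\<lambda>x::real^'n. \<bar>x \<bullet> b\<bar>)" if "b \<in> Basis" for b
  proof (rule integrable_sphere_measure)
    show "\<bar>\<bar>x \<bullet> b\<bar>\<bar> \<le> 1" if "norm x = 1" for x :: "real^'n"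
      using Basis_le_norm[OF \<open>b \<in> Basis\<close>, of x] that by simp
  qed simp
  \<comment> \<open>Positivity of \<open>c\<close>: the l1 norm dominates the Euclidean norm, and
    each coordinate has mean absolute value \<open>c\<close>, so 1 is at most the dimension times
    \<open>c\<close>.\<close>
  have "1 = measure (sphere_measure :: (real^'n) measure) (space sphere_measure)" by (rule prob_space[symmetric])
  also have "\<dots> = (\<integral>x. 1 \<partial>(sphere_measure :: (real^'n) measure))" by (simp only: lebesgue_integral_const real_scaleR_def mult_1_right)
  also have "\<dots> \<le> (\<integral>x. (\<Sum>b\<in>Basis. \<bar>x \<bullet> b\<bar>) \<partial>(sphere_measure :: (real^'n) measure))"
  proof (rule integral_mono_AE)
    show "AE x in sphere_measure. 1 \<le> (\<Sum>b\<in>Basis. \<bar>(x::real^'n) \<bullet> b\<bar>)"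
      using AE_sphere_measure
    proof eventually_elim
      case (elim x)
      then show ?case using norm_le_l1[of x] by simp
    qed
  qed (auto intro!: int)
  also have "\<dots> = (\<Sum>b\<in>(Basis::(real^'n) set). \<integral>x. \<bar>x \<bullet> b\<bar> \<partial>sphere_measure)"
    by (rule Bochner_Integration.integral_sum) (rule int)
  also have "\<dots> = real (card (Basis::(real^'n) set)) * c" by (simp add: eq)
  finally have "c > 0" by (smt (verit) mult_nonneg_nonpos of_nat_0_le_iff)
  with eq show ?thesis using that by blast
qed

subsection \<open>Gaussian integrals and averages\<close>

lemma nn_integral_gaussian:
  fixes a :: real assumes "a > 0"
  shows "(\<integral>\<^sup>+x. ennreal (exp (- x\<^sup>2 / a\<^sup>2)) \<partial>lborel) = ennreal (a * sqrt pi)"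
proof -
  have s: "a / sqrt 2 > 0" using assms by simp
  \<comment> \<open>Standard deviation \<open>a / sqrt 2\<close> gives the exponent -x^2/a^2 and the
    normalizing factor 1/(a sqrt pi).\<close>
  have "(\<integral>\<^sup>+x. ennreal (exp (- x\<^sup>2 / a\<^sup>2)) \<partial>lborel) = (\<integral>\<^sup>+x. ennreal ((a * sqrt pi) * normal_density 0 (a / sqrt 2) x) \<partial>lborel)"
    using assms by (intro nn_integral_cong) (simp add: normal_density_def power_divide real_sqrt_mult)
  also have "\<dots> = ennreal (a * sqrt pi)"
    using assms s
    by (subst nn_integral_eq_integral) (auto simp: integral_normal_density)
  finally show ?thesis .
qed

text \<open>Coordinates of \<open>e\<close> other than its own vanish, and projecting a point of the
  unit ball to the sphere can only enlarge the absolute values of its coordinates. Dropping the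
  coordinate along \<open>e\<close> leaves a product in the coordinates of \<open>x\<close> itself,
  so the integral over the ball will factorize.\<close>

lemma axis_sphere_gaussian_le:
  fixes s :: real and x :: "real^'n"
  assumes s: "s > 0" and x: "norm x \<le> 1" and e: "e \<in> Basis"
  shows "exp (- (norm (e - x /\<^sub>R norm x))\<^sup>2 / s\<^sup>2) \<le> (\<Prod>b\<in>Basis - {e}. exp (- (x \<bullet> b)\<^sup>2 / s\<^sup>2))"
proof -
  define w where "w = x /\<^sub>R norm x"
  have "(x \<bullet> b)\<^sup>2 \<le> ((e - w) \<bullet> b)\<^sup>2" if "b \<in> Basis - {e}" for b
  proof -
    have "e \<bullet> b = 0" using e that by (metis Diff_iff inner_not_same_Basis insertI1)
    moreover have "\<bar>x \<bullet> b\<bar> \<le> \<bar>w \<bullet> b\<bar>"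
      using x mult_right_mono[of 1 "inverse (norm x)" "\<bar>x \<bullet> b\<bar>"]
      by (cases "x = 0") (simp_all add: w_def abs_mult one_le_inverse)
    ultimately show ?thesis by (simp add: inner_diff_left abs_le_square_iff)
  qed
  then have "(\<Sum>b\<in>Basis - {e}. (x \<bullet> b)\<^sup>2) \<le> (\<Sum>b\<in>Basis - {e}. ((e - w) \<bullet> b)\<^sup>2)"
    by (rule sum_mono)
  also have "\<dots> \<le> (\<Sum>b\<in>Basis. ((e - w) \<bullet> b)\<^sup>2)"
    by (rule sum_mono2) auto
  also have "\<dots> = (norm (e - w))\<^sup>2"
    unfolding power2_norm_eq_inner by (subst euclidean_inner) (simp add: power2_eq_square)
  finally have "(\<Sum>b\<in>Basis - {e}. (x \<bullet> b)\<^sup>2) / s\<^sup>2 \<le> (norm (e - w))\<^sup>2 / s\<^sup>2"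
    by (simp add: divide_right_mono)
  then show ?thesis
    by (simp add: exp_sum[symmetric] w_def[symmetric] sum_divide_distrib sum_negf)
qed

text \<open>After rotating \<open>y\<close> to a coordinate vector, the integral over the ball is
  bounded by a product of one-dimensional integrals. Each of the d directions orthogonal to that
  vector contributes a factor proportional to \<open>s\<close>.\<close>

lemma integral_sphere_gaussian_le:
  obtains C :: real where "C > 0"
    "\<And>s y::real^'n. s > 0 \<Longrightarrow> norm y = 1 \<Longrightarrow>
       (\<integral>z. exp (- (norm (y - z))\<^sup>2 / s\<^sup>2) \<partial>sphere_measure) \<le> C * s ^ (CARD('n) - 1)"
proof -
  interpret prob_space "sphere_measure :: (real^'n) measure" by (rule prob_space_sphere_measure)
  let ?V = "emeasure lborel (ball (0::real^'n) 1)"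
  define V where "V = measure lborel (ball (0::real^'n) 1)"
  have V: "?V = ennreal V" "V > 0"
    using emeasure_unit_ball[where 'n='n] content_ball_pos[of 1 "0::real^'n"]
    by (simp_all add: V_def emeasure_eq_ennreal_measure)
  \<comment> \<open>The 2 is the length of [-1,1], the range of the coordinate along
    \<open>e\<close>; each remaining coordinate gives \<open>sqrt pi\<close>, and \<open>V\<close>
    normalizes the cone measure.\<close>
  define C where "C = 2 * sqrt pi ^ (CARD('n) - 1) / V"
  define e :: "real^'n" where "e = axis undefined 1"
  have e: "e \<in> Basis" by (simp add: e_def axis_in_Basis_iff)
  have main: "(\<integral>z. exp (- (norm (y - z))\<^sup>2 / s\<^sup>2) \<partial>sphere_measure) \<le> C * s ^ (CARD('n) - 1)"
    if s: "s > 0" and y: "norm y = 1" for s and y :: "real^'n"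
  proof -
    have "norm y = norm e" using y e by simp
    then obtain f where f: "orthogonal_transformation f" and fy: "f y = e"
      by (rule orthogonal_transformation_exists)
    have lin: "linear f" and nf: "norm (f z) = norm z" for z
      using f by (auto simp: orthogonal_transformation)
    define g where "g b t = (if b = e then indicator {-1..1} t else exp (- t\<^sup>2 / s\<^sup>2))" for b :: "real^'n" and t :: real
    have [measurable]: "g b \<in> borel_measurable borel" for b
      unfolding g_def by (cases "b = e") simp_all
    have "(\<integral>z. exp (- (norm (y - z))\<^sup>2 / s\<^sup>2) \<partial>sphere_measure) = (\<integral>z. exp (- (norm (e - f z))\<^sup>2 / s\<^sup>2) \<partial>sphere_measure)"
    proof -
      have "norm (y - z) = norm (e - f z)" for z using nf[of "y - z"] by (simp add: linear_diff[OF lin] fy)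
      then show ?thesis by simp
    qed
    also have "\<dots> = (\<integral>z. exp (- (norm (e - z))\<^sup>2 / s\<^sup>2) \<partial>sphere_measure)"
      by (rule integral_sphere_measure_orthogonal[OF f]) simp
    finally have "ennreal (\<integral>z. exp (- (norm (y - z))\<^sup>2 / s\<^sup>2) \<partial>sphere_measure)
        = (\<integral>\<^sup>+z. ennreal (exp (- (norm (e - z))\<^sup>2 / s\<^sup>2)) \<partial>sphere_measure)"
      by (subst nn_integral_eq_integral) (auto intro!: integrable_const_bound[of _ 1])
    also have "\<dots> = (\<integral>\<^sup>+x. ennreal (exp (- (norm (e - x /\<^sub>R norm x))\<^sup>2 / s\<^sup>2)) * indicator (ball 0 1) x \<partial>lborel) / ?V"
      by (rule nn_integral_sphere_measure) simp
    also have "\<dots> \<le> (\<integral>\<^sup>+x. (\<Prod>b\<in>Basis. ennreal (g b (x \<bullet> b))) \<partial>lborel) / ?V"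
    proof (intro divide_right_mono_ennreal nn_integral_mono)
      fix x :: "real^'n"
      show "ennreal (exp (- (norm (e - x /\<^sub>R norm x))\<^sup>2 / s\<^sup>2)) * indicator (ball 0 1) x \<le> (\<Prod>b\<in>Basis. ennreal (g b (x \<bullet> b)))"
      proof (cases "x \<in> ball 0 1")
        case True
        then have "norm x \<le> 1" by simp
        then have "g e (x \<bullet> e) = 1"
          using Basis_le_norm[OF e, of x] by (auto simp: g_def indicator_def)
        then have "(\<Prod>b\<in>Basis. g b (x \<bullet> b)) = (\<Prod>b\<in>Basis - {e}. g b (x \<bullet> b))"
          by (simp add: prod.remove[OF _ e])
        also have "\<dots> = (\<Prod>b\<in>Basis - {e}. exp (- (x \<bullet> b)\<^sup>2 / s\<^sup>2))"
          by (rule prod.cong) (auto simp: g_def)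
        finally have "exp (- (norm (e - x /\<^sub>R norm x))\<^sup>2 / s\<^sup>2) \<le> (\<Prod>b\<in>Basis. g b (x \<bullet> b))"
          using axis_sphere_gaussian_le[OF s \<open>norm x \<le> 1\<close> e] by simp
        then show ?thesis using True
          by (subst prod_ennreal) (auto simp: g_def intro!: ennreal_leI)
      qed simp
    qed
    also have "(\<integral>\<^sup>+x. (\<Prod>b\<in>(Basis::(real^'n) set). ennreal (g b (x \<bullet> b))) \<partial>lborel) = (\<Prod>b\<in>(Basis::(real^'n) set). \<integral>\<^sup>+t. ennreal (g b t) \<partial>lborel)"
      by (rule nn_integral_lborel_prod) simp_all
    also have "\<dots> = (\<integral>\<^sup>+t. ennreal (g e t) \<partial>lborel) * (\<Prod>b\<in>(Basis::(real^'n) set) - {e}. \<integral>\<^sup>+t. ennreal (g b t) \<partial>lborel)"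
      by (rule prod.remove) (simp_all add: e)
    also have "(\<integral>\<^sup>+t. ennreal (g e t) \<partial>lborel) = ennreal 2"
    proof -
      have "(\<integral>\<^sup>+t. ennreal (g e t) \<partial>lborel) = (\<integral>\<^sup>+t. indicator {-1..1::real} t \<partial>lborel)"
        by (intro nn_integral_cong) (auto simp: g_def indicator_def)
      then show ?thesis by simp
    qed
    also have "(\<Prod>b\<in>(Basis::(real^'n) set) - {e}. \<integral>\<^sup>+t. ennreal (g b t) \<partial>lborel) = (\<Prod>b\<in>(Basis::(real^'n) set) - {e}. ennreal (s * sqrt pi))"
      using nn_integral_gaussian[OF s] by (intro prod.cong) (auto simp: g_def)
    also have "\<dots> = ennreal ((s * sqrt pi) ^ (CARD('n) - 1))"
      using s e by (simp add: card_Diff_singleton ennreal_power)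
    also have "ennreal 2 * ennreal ((s * sqrt pi) ^ (CARD('n) - 1)) / ?V = ennreal (C * s ^ (CARD('n) - 1))"
      unfolding V(1) using s V(2)
      by (subst ennreal_mult[symmetric], simp, simp, subst divide_ennreal) (simp_all add: C_def power_mult_distrib mult_ac)
    finally show ?thesis
      using s V by (simp add: C_def)
  qed
  have "C > 0" using V by (simp add: C_def)
  with main show ?thesis using that by blast
qed

section \<open>Kernels as integrals of products\<close>

text \<open>Tonelli: a product of two averages is an average over pairs, and integrating over the
  parameter \<open>u\<close> first produces the kernel \<open>k\<close>. The assumptions on
  \<open>k\<close> hold only almost everywhere because the kernels are controlled only for points on
  the sphere.\<close>

lemma
  fixes \<phi> :: "'u \<Rightarrow> 'a \<Rightarrow> real" and k :: "'a \<times> 'a \<Rightarrow> real"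
  assumes M: "sigma_finite_measure M" and \<alpha>: "prob_space \<alpha>" and \<beta>: "prob_space \<beta>"
    and \<phi>1 [measurable]: "case_prod \<phi> \<in> borel_measurable (M \<Otimes>\<^sub>M \<alpha>)"
    and \<phi>2 [measurable]: "case_prod \<phi> \<in> borel_measurable (M \<Otimes>\<^sub>M \<beta>)"
    and \<phi>: "\<And>u y. 0 \<le> \<phi> u y" "\<And>u y. \<phi> u y \<le> 1"
    and k [measurable]: "k \<in> borel_measurable (\<alpha> \<Otimes>\<^sub>M \<beta>)"
    and kB: "AE p in \<alpha> \<Otimes>\<^sub>M \<beta>. 0 \<le> k p \<and> k p \<le> B"
    and k\<phi>: "AE p in \<alpha> \<Otimes>\<^sub>M \<beta>. (\<integral>\<^sup>+u. ennreal (\<phi> u (fst p) * \<phi> u (snd p)) \<partial>M) = ennreal (k p)"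
  shows integrable_mult_averages: "integrable M (\<lambda>u. (\<integral>y. \<phi> u y \<partial>\<alpha>) * (\<integral>y. \<phi> u y \<partial>\<beta>))" (is ?I)
    and integral_mult_averages:
      "(\<integral>u. (\<integral>y. \<phi> u y \<partial>\<alpha>) * (\<integral>y. \<phi> u y \<partial>\<beta>) \<partial>M) = (\<integral>p. k p \<partial>(\<alpha> \<Otimes>\<^sub>M \<beta>))" (is ?E)
proof -
  interpret M: sigma_finite_measure M by fact
  interpret a: prob_space \<alpha> by fact
  interpret b: prob_space \<beta> by fact
  interpret ab: pair_prob_space \<alpha> \<beta> ..
  interpret Mab: pair_sigma_finite M "\<alpha> \<Otimes>\<^sub>M \<beta>" ..
  let ?P = "\<alpha> \<Otimes>\<^sub>M \<beta>"
  have prod: "ennreal ((\<integral>y. \<phi> u y \<partial>\<alpha>) * (\<integral>y. \<phi> u y \<partial>\<beta>)) = (\<integral>\<^sup>+p. ennreal (\<phi> u (fst p) * \<phi> u (snd p)) \<partial>?P)"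
    if u[measurable]: "u \<in> space M" for u
  proof -
    have [measurable]: "\<phi> u \<in> borel_measurable \<alpha>" "\<phi> u \<in> borel_measurable \<beta>"
      using measurable_Pair2[OF \<phi>1 u] measurable_Pair2[OF \<phi>2 u] by simp_all
    have "(\<integral>\<^sup>+p. ennreal (\<phi> u (fst p) * \<phi> u (snd p)) \<partial>?P) = (\<integral>\<^sup>+y. \<integral>\<^sup>+z. ennreal (\<phi> u y) * ennreal (\<phi> u z) \<partial>\<beta> \<partial>\<alpha>)"
      by (subst b.nn_integral_fst[symmetric]) (simp_all add: ennreal_mult \<phi>)
    also have "\<dots> = (\<integral>\<^sup>+y. ennreal (\<phi> u y) \<partial>\<alpha>) * (\<integral>\<^sup>+z. ennreal (\<phi> u z) \<partial>\<beta>)"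
      by (simp add: nn_integral_cmult nn_integral_multc)
    also have "(\<integral>\<^sup>+y. ennreal (\<phi> u y) \<partial>\<alpha>) = ennreal (\<integral>y. \<phi> u y \<partial>\<alpha>)"
      by (rule nn_integral_eq_integral) (auto simp: \<phi> intro!: a.integrable_const_bound[of _ 1])
    also have "(\<integral>\<^sup>+y. ennreal (\<phi> u y) \<partial>\<beta>) = ennreal (\<integral>y. \<phi> u y \<partial>\<beta>)"
      by (rule nn_integral_eq_integral) (auto simp: \<phi> intro!: b.integrable_const_bound[of _ 1])
    finally show ?thesis by (simp add: ennreal_mult \<phi>)
  qed
  have m1[measurable]: "(\<lambda>x. \<phi> (fst x) (fst (snd x))) \<in> borel_measurable (M \<Otimes>\<^sub>M ?P)"
    using measurable_compose[OF _ \<phi>1, of "\<lambda>x. (fst x, fst (snd x))" "M \<Otimes>\<^sub>M ?P"] by simp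
  have m2[measurable]: "(\<lambda>x. \<phi> (fst x) (snd (snd x))) \<in> borel_measurable (M \<Otimes>\<^sub>M ?P)"
    using measurable_compose[OF _ \<phi>2, of "\<lambda>x. (fst x, snd (snd x))" "M \<Otimes>\<^sub>M ?P"] by simp
  have "(\<integral>\<^sup>+u. ennreal ((\<integral>y. \<phi> u y \<partial>\<alpha>) * (\<integral>y. \<phi> u y \<partial>\<beta>)) \<partial>M)
    = (\<integral>\<^sup>+u. \<integral>\<^sup>+p. ennreal (\<phi> u (fst p) * \<phi> u (snd p)) \<partial>?P \<partial>M)"
    by (rule nn_integral_cong) (rule prod)
  also have "\<dots> = (\<integral>\<^sup>+p. \<integral>\<^sup>+u. ennreal (\<phi> u (fst p) * \<phi> u (snd p)) \<partial>M \<partial>?P)"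
    by (rule Mab.Fubini'[symmetric]) (simp add: case_prod_beta)
  also have "\<dots> = (\<integral>\<^sup>+p. ennreal (k p) \<partial>?P)"
    using k\<phi> by (rule nn_integral_cong_AE)
  also have "\<dots> = ennreal (\<integral>p. k p \<partial>?P)"
    using kB by (intro nn_integral_eq_integral ab.integrable_const_bound[of _ B]) auto
  finally have *: "(\<integral>\<^sup>+u. ennreal ((\<integral>y. \<phi> u y \<partial>\<alpha>) * (\<integral>y. \<phi> u y \<partial>\<beta>)) \<partial>M) = ennreal (\<integral>p. k p \<partial>?P)" .
  have "has_bochner_integral M (\<lambda>u. (\<integral>y. \<phi> u y \<partial>\<alpha>) * (\<integral>y. \<phi> u y \<partial>\<beta>)) (\<integral>p. k p \<partial>?P)"
    using kB
    by (intro has_bochner_integral_nn_integral *)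
       (auto intro!: integral_nonneg_AE mult_nonneg_nonneg integral_nonneg borel_measurable_times
          a.borel_measurable_lebesgue_integral b.borel_measurable_lebesgue_integral simp: \<phi>)
  then show ?I ?E by (auto simp: has_bochner_integral_iff)
qed

lemma nn_integral_gaussian_norm:
  fixes m :: "'a::euclidean_space"
  assumes a: "a > 0"
  shows "(\<integral>\<^sup>+u. ennreal (exp (- (norm (u - m))\<^sup>2 / a\<^sup>2)) \<partial>lborel) = ennreal ((a * sqrt pi) ^ DIM('a))"
proof -
  have "(\<integral>\<^sup>+u. ennreal (exp (- (norm (u - m))\<^sup>2 / a\<^sup>2)) \<partial>lborel) = (\<integral>\<^sup>+u. ennreal (exp (- (norm (u::'a))\<^sup>2 / a\<^sup>2)) \<partial>lborel)"
    using nn_integral_lborel_translation[of "\<lambda>u::'a. ennreal (exp (- (norm u)\<^sup>2 / a\<^sup>2))" "-m"] by simp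
  also have "\<dots> = (\<integral>\<^sup>+u. (\<Prod>b\<in>(Basis::'a set). ennreal (exp (- (u \<bullet> b)\<^sup>2 / a\<^sup>2))) \<partial>lborel)"
  proof (rule nn_integral_cong)
    fix u :: 'a
    have "(norm u)\<^sup>2 = (\<Sum>b\<in>Basis. (u \<bullet> b)\<^sup>2)"
      unfolding power2_norm_eq_inner by (subst euclidean_inner) (simp add: power2_eq_square)
    then show "ennreal (exp (- (norm u)\<^sup>2 / a\<^sup>2)) = (\<Prod>b\<in>(Basis::'a set). ennreal (exp (- (u \<bullet> b)\<^sup>2 / a\<^sup>2)))"
      by (simp add: prod_ennreal exp_sum[symmetric] sum_divide_distrib sum_negf)
  qed
  also have "\<dots> = (\<Prod>b\<in>(Basis::'a set). \<integral>\<^sup>+t. ennreal (exp (- t\<^sup>2 / a\<^sup>2)) \<partial>lborel)"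
    by (subst nn_integral_lborel_prod) simp_all
  finally show ?thesis using a nn_integral_gaussian[OF a] by (simp add: ennreal_power)
qed

subsection \<open>Energies of pairs of measures on the sphere\<close>

text \<open>Covers the surface measure and the empirical measures alike, so each identity for a
  double integral is proved once and then used for all the pairs in an energy.\<close>

definition sphere_prob :: "(real^'n) measure \<Rightarrow> bool" where
  "sphere_prob \<alpha> \<longleftrightarrow> prob_space \<alpha> \<and> sets \<alpha> = sets borel \<and> (AE x in \<alpha>. norm x = 1)"

text \<open>The double integral of a symmetric kernel against the square of the signed measure \<alpha> - \<beta>.\<close>
definition energy :: "((real^'n) \<times> (real^'n) \<Rightarrow> real) \<Rightarrow> (real^'n) measure \<Rightarrow> (real^'n) measure \<Rightarrow> real" where
  "energy k \<alpha> \<beta> = (\<integral>p. k p \<partial>(\<alpha> \<Otimes>\<^sub>M \<alpha>)) - 2 * (\<integral>p. k p \<partial>(\<alpha> \<Otimes>\<^sub>M \<beta>)) + (\<integral>p. k p \<partial>(\<beta> \<Otimes>\<^sub>M \<beta>))"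

lemma sphere_probD:
  assumes "sphere_prob \<alpha>"
  shows "prob_space \<alpha>" "sets \<alpha> = sets borel" "AE x in \<alpha>. norm x = 1" "space \<alpha> = UNIV"
  using assms sets_eq_imp_space_eq[of \<alpha> borel] by (auto simp: sphere_prob_def)

lemma sphere_prob_sphere_measure: "sphere_prob sphere_measure"
  using AE_sphere_measure by (auto simp: sphere_prob_def prob_space_sphere_measure)

lemma sets_pair_sphere_prob:
  "sphere_prob \<alpha> \<Longrightarrow> sphere_prob \<beta> \<Longrightarrow> sets (\<alpha> \<Otimes>\<^sub>M \<beta>) = sets (borel \<Otimes>\<^sub>M borel)"
  by (intro sets_pair_measure_cong sphere_probD)

lemma AE_pair_sphere_prob:
  assumes "sphere_prob \<alpha>" "sphere_prob \<beta>"
  shows "AE p in \<alpha> \<Otimes>\<^sub>M \<beta>. norm (fst p) = 1 \<and> norm (snd p) = 1"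
proof -
  note d = sphere_probD[OF assms(1)] sphere_probD[OF assms(2)]
  interpret a: prob_space \<alpha> by fact
  interpret b: prob_space \<beta> by fact
  interpret pair_prob_space \<alpha> \<beta> ..
  have [measurable_cong]: "sets \<alpha> = sets borel" "sets \<beta> = sets borel" by fact+
  have "AE x in \<alpha>. AE y in \<beta>. norm x = 1 \<and> norm y = 1"
    using d(3) by eventually_elim (use d(7) in simp)
  moreover have "{p \<in> space (\<alpha> \<Otimes>\<^sub>M \<beta>). norm (fst p) = 1 \<and> norm (snd p) = 1} \<in> sets (\<alpha> \<Otimes>\<^sub>M \<beta>)"
    by measurable
  ultimately show ?thesis
    by (intro AE_pair_measure) auto
qed

lemma prob_space_pair_sphere_prob:
  "sphere_prob \<alpha> \<Longrightarrow> sphere_prob \<beta> \<Longrightarrow> prob_space (\<alpha> \<Otimes>\<^sub>M \<beta>)"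
  by (simp add: prob_space_pair sphere_probD)

lemma integrable_pair_sphere_prob:
  fixes k :: "(real^'n) \<times> (real^'n) \<Rightarrow> real"
  assumes a: "sphere_prob \<alpha>" and b: "sphere_prob \<beta>"
    and k: "k \<in> borel_measurable (borel \<Otimes>\<^sub>M borel)"
    and B: "\<And>y z. norm y = 1 \<Longrightarrow> norm z = 1 \<Longrightarrow> \<bar>k (y, z)\<bar> \<le> B"
  shows "integrable (\<alpha> \<Otimes>\<^sub>M \<beta>) k"
proof -
  interpret prob_space "\<alpha> \<Otimes>\<^sub>M \<beta>" by (rule prob_space_pair_sphere_prob[OF a b])
  show ?thesis
  proof (rule integrable_const_bound)
    show "AE p in \<alpha> \<Otimes>\<^sub>M \<beta>. norm (k p) \<le> B"
      using AE_pair_sphere_prob[OF a b] by eventually_elim (use B in auto)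
    show "k \<in> borel_measurable (\<alpha> \<Otimes>\<^sub>M \<beta>)"
      using k by (simp add: measurable_cong_sets[OF sets_pair_sphere_prob[OF a b] refl])
  qed
qed

lemma integrable_pair_norm_diff:
  fixes \<alpha> \<beta> :: "(real^'n) measure"
  assumes "sphere_prob \<alpha>" "sphere_prob \<beta>"
  shows "integrable (\<alpha> \<Otimes>\<^sub>M \<beta>) (\<lambda>p. norm (fst p - snd p))"
proof (rule integrable_pair_sphere_prob[OF assms, of _ 2])
  show "\<bar>norm (fst (y, z) - snd (y, z))\<bar> \<le> 2" if "norm y = 1" "norm z = 1" for y z :: "real^'n"
    using norm_triangle_ineq4[of y z] that by simp
qed measurable

text \<open>Expanding the square gives three products of averages, each a double integral of
  \<open>k\<close>. It is applied with cap indicators to obtain Stolarsky's identity and with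
  Gaussians to obtain positive definiteness.\<close>

lemma square_diff_averages:
  fixes \<phi> :: "'u \<Rightarrow> real^'n \<Rightarrow> real"
  assumes M: "sigma_finite_measure M" and a: "sphere_prob \<alpha>" and b: "sphere_prob \<beta>"
    and \<phi>m: "case_prod \<phi> \<in> borel_measurable (M \<Otimes>\<^sub>M borel)"
    and \<phi>: "\<And>u y. 0 \<le> \<phi> u y" "\<And>u y. \<phi> u y \<le> 1"
    and k: "k \<in> borel_measurable (borel \<Otimes>\<^sub>M borel)"
    and kB: "\<And>y z. norm y = 1 \<Longrightarrow> norm z = 1 \<Longrightarrow> 0 \<le> k (y, z) \<and> k (y, z) \<le> B"
    and k\<phi>: "\<And>y z. norm y = 1 \<Longrightarrow> norm z = 1 \<Longrightarrow>
       (\<integral>\<^sup>+u. ennreal (\<phi> u y * \<phi> u z) \<partial>M) = ennreal (k (y, z))"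
  shows "has_bochner_integral M (\<lambda>u. ((\<integral>y. \<phi> u y \<partial>\<alpha>) - (\<integral>y. \<phi> u y \<partial>\<beta>))\<^sup>2) (energy k \<alpha> \<beta>)"
proof -
  have *: "has_bochner_integral M (\<lambda>u. (\<integral>y. \<phi> u y \<partial>\<mu>) * (\<integral>y. \<phi> u y \<partial>\<nu>)) (\<integral>p. k p \<partial>(\<mu> \<Otimes>\<^sub>M \<nu>))"
    if m: "sphere_prob \<mu>" and n: "sphere_prob \<nu>" for \<mu> \<nu> :: "(real^'n) measure"
  proof -
    have s: "sets \<mu> = sets borel" "sets \<nu> = sets borel" using m n by (auto simp: sphere_probD)
    have m1: "case_prod \<phi> \<in> borel_measurable (M \<Otimes>\<^sub>M \<mu>)" "case_prod \<phi> \<in> borel_measurable (M \<Otimes>\<^sub>M \<nu>)"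
      using \<phi>m by (simp_all add: measurable_cong_sets[OF sets_pair_measure_cong[OF refl s(1)] refl]
          measurable_cong_sets[OF sets_pair_measure_cong[OF refl s(2)] refl])
    have m2: "k \<in> borel_measurable (\<mu> \<Otimes>\<^sub>M \<nu>)"
      using k by (simp add: measurable_cong_sets[OF sets_pair_sphere_prob[OF m n] refl])
    have ae: "AE p in \<mu> \<Otimes>\<^sub>M \<nu>. 0 \<le> k p \<and> k p \<le> B"
      "AE p in \<mu> \<Otimes>\<^sub>M \<nu>. (\<integral>\<^sup>+u. ennreal (\<phi> u (fst p) * \<phi> u (snd p)) \<partial>M) = ennreal (k p)"
      using AE_pair_sphere_prob[OF m n] by (eventually_elim; use kB k\<phi> in force)+
    note r = M sphere_probD(1)[OF m] sphere_probD(1)[OF n] m1 \<phi> m2 ae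
    show ?thesis
      using integrable_mult_averages[OF r] integral_mult_averages[OF r] by (simp add: has_bochner_integral_iff)
  qed
  have "has_bochner_integral M (\<lambda>u. (\<integral>y. \<phi> u y \<partial>\<alpha>) * (\<integral>y. \<phi> u y \<partial>\<alpha>)
      - 2 * ((\<integral>y. \<phi> u y \<partial>\<alpha>) * (\<integral>y. \<phi> u y \<partial>\<beta>)) + (\<integral>y. \<phi> u y \<partial>\<beta>) * (\<integral>y. \<phi> u y \<partial>\<beta>)) (energy k \<alpha> \<beta>)"
    unfolding energy_def
    by (intro has_bochner_integral_add has_bochner_integral_diff has_bochner_integral_mult_right * a b)
  then show ?thesis by (simp add: power2_eq_square algebra_simps)
qed

definition gauss_kernel :: "real \<Rightarrow> (real^'n) \<times> (real^'n) \<Rightarrow> real" where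
  "gauss_kernel s p = exp (- (norm (fst p - snd p))\<^sup>2 / s\<^sup>2)"

lemma gauss_kernel_measurable [measurable]: "gauss_kernel s \<in> borel_measurable (borel \<Otimes>\<^sub>M borel)"
  unfolding gauss_kernel_def by measurable

text \<open>A Gaussian kernel is, up to a constant, the convolution of a narrower Gaussian with
  itself. Its energy is therefore a positive multiple of the integral of a square.\<close>

lemma energy_gauss_kernel_nonneg:
  fixes \<alpha> \<beta> :: "(real^'n) measure"
  assumes s: "s > 0" and a: "sphere_prob \<alpha>" and b: "sphere_prob \<beta>"
  shows "energy (gauss_kernel s) \<alpha> \<beta> \<ge> 0"
proof -
  define \<phi> where "\<phi> u y = exp (- 2 * (norm (u - y))\<^sup>2 / s\<^sup>2)" for u y :: "real^'n"
  \<comment> \<open>The mass of the Gaussian of width \<open>s / 2\<close> that remains once the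
    product of the two narrow Gaussians is centred at the midpoint of their centres.\<close>
  define V where "V = (s / 2 * sqrt pi) ^ CARD('n)"
  have V: "V > 0" using s by (simp add: V_def)
  define k where "k p = V * gauss_kernel s p" for p :: "(real^'n) \<times> (real^'n)"
  have "has_bochner_integral lborel (\<lambda>u. ((\<integral>y. \<phi> u y \<partial>\<alpha>) - (\<integral>y. \<phi> u y \<partial>\<beta>))\<^sup>2) (energy k \<alpha> \<beta>)"
  proof (rule square_diff_averages[OF _ a b])
    show "sigma_finite_measure (lborel :: (real^'n) measure)" by (rule sigma_finite_lborel)
    show "case_prod \<phi> \<in> borel_measurable (lborel \<Otimes>\<^sub>M borel)" unfolding \<phi>_def by measurable
    show "0 \<le> \<phi> u y" "\<phi> u y \<le> 1" for u y by (auto simp: \<phi>_def)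
    show "k \<in> borel_measurable (borel \<Otimes>\<^sub>M borel)" unfolding k_def by measurable
    show "0 \<le> k (y, z) \<and> k (y, z) \<le> V" for y z using V by (auto simp: k_def gauss_kernel_def mult_le_cancel_left1)
    show "(\<integral>\<^sup>+u. ennreal (\<phi> u y * \<phi> u z) \<partial>lborel) = ennreal (k (y, z))" for y z
    proof -
      let ?m = "(1/2) *\<^sub>R (y + z)"
      \<comment> \<open>The parallelogram law for \<open>u - y\<close> and \<open>u - z\<close>,
        which separates the distance of the centres from the dependence on \<open>u\<close>.\<close>
      have par: "- 2 * (norm (u - y))\<^sup>2 + - 2 * (norm (u - z))\<^sup>2 = - (norm (y - z))\<^sup>2 - 4 * (norm (u - ?m))\<^sup>2" for u
        unfolding power2_norm_eq_inner by (simp add: inner_diff_left inner_diff_right inner_add_left inner_add_right inner_commute algebra_simps)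
      have "\<phi> u y * \<phi> u z = exp ((- (norm (y - z))\<^sup>2 - 4 * (norm (u - ?m))\<^sup>2) / s\<^sup>2)" for u
        unfolding \<phi>_def exp_add[symmetric] add_divide_distrib[symmetric] par ..
      also have "\<dots> u = gauss_kernel s (y, z) * exp (- (norm (u - ?m))\<^sup>2 / (s / 2)\<^sup>2)" for u
        by (simp add: gauss_kernel_def exp_add[symmetric] diff_divide_distrib power_divide)
      finally have "(\<integral>\<^sup>+u. ennreal (\<phi> u y * \<phi> u z) \<partial>lborel)
        = (\<integral>\<^sup>+u. ennreal (gauss_kernel s (y, z)) * ennreal (exp (- (norm (u - ?m))\<^sup>2 / (s / 2)\<^sup>2)) \<partial>lborel)"
        by (simp add: ennreal_mult gauss_kernel_def)
      also have "\<dots> = ennreal (gauss_kernel s (y, z)) * ennreal V"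
        using nn_integral_gaussian_norm[of "s / 2" ?m] s by (subst nn_integral_cmult) (simp_all add: V_def)
      finally show ?thesis using V by (simp add: k_def ennreal_mult mult.commute gauss_kernel_def)
    qed
  qed
  from has_bochner_integral_integral_eq[OF this, symmetric] have "energy k \<alpha> \<beta> \<ge> 0"
    by simp
  moreover have "energy k \<alpha> \<beta> = V * energy (gauss_kernel s) \<alpha> \<beta>"
    unfolding energy_def k_def by (simp only: integral_mult_right_zero) (simp add: algebra_simps)
  ultimately show ?thesis using V by (simp add: zero_le_mult_iff)
qed

subsection \<open>Empirical measures and the Gaussian representation of the norm\<close>

text \<open>Every set is measurable for the measure of a pmf; the push-forward along the identity
  restricts it to the Borel sets, as \<open>sphere_prob\<close> demands.\<close>

definition empirical :: "(real^'n) set \<Rightarrow> (real^'n) measure" where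
  "empirical Z = distr (measure_pmf (pmf_of_set Z)) borel (\<lambda>x. x)"

lemma sets_empirical [simp, measurable_cong]: "sets (empirical Z) = sets borel"
  by (simp add: empirical_def)

lemma sphere_prob_empirical:
  assumes "finite Z" "Z \<noteq> {}" "Z \<subseteq> sphere 0 1"
  shows "sphere_prob (empirical Z)"
proof -
  have "AE x in empirical Z. norm x = 1"
    unfolding empirical_def using assms
    by (subst AE_distr_iff) (auto simp: AE_measure_pmf_iff)
  moreover have "prob_space (empirical Z)"
    unfolding empirical_def by (intro prob_space.prob_space_distr measure_pmf.prob_space_axioms) simp
  ultimately show ?thesis by (simp add: sphere_prob_def)
qed

lemma integral_empirical:
  fixes f :: "real^'n \<Rightarrow> real"
  assumes "finite Z" "Z \<noteq> {}" "f \<in> borel_measurable borel"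
  shows "(\<integral>x. f x \<partial>empirical Z) = (\<Sum>z\<in>Z. f z) / card Z"
  unfolding empirical_def using assms
  by (subst integral_distr) (simp_all add: integral_pmf_of_set)

lemma integral_pair_empirical:
  fixes k :: "(real^'n) \<times> (real^'n) \<Rightarrow> real"
  assumes Z: "finite Z" "Z \<noteq> {}" "Z \<subseteq> sphere 0 1"
    and k: "k \<in> borel_measurable (borel \<Otimes>\<^sub>M borel)"
    and B: "\<And>y z. norm y = 1 \<Longrightarrow> norm z = 1 \<Longrightarrow> \<bar>k (y, z)\<bar> \<le> B"
  shows "(\<integral>p. k p \<partial>(empirical Z \<Otimes>\<^sub>M empirical Z)) = (\<Sum>y\<in>Z. \<Sum>z\<in>Z. k (y, z)) / (real (card Z))\<^sup>2"
proof -
  note e = sphere_prob_empirical[OF Z]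
  interpret e: prob_space "empirical Z" by (rule sphere_probD(1)[OF e])
  interpret pair_prob_space "empirical Z" "empirical Z" ..
  have k': "k \<in> borel_measurable (borel \<Otimes>\<^sub>M empirical Z)"
    using k by (simp add: measurable_cong_sets[OF sets_pair_measure_cong[OF refl sets_empirical] refl])
  have "(\<integral>p. k p \<partial>(empirical Z \<Otimes>\<^sub>M empirical Z)) = (\<integral>y. \<integral>z. k (y, z) \<partial>empirical Z \<partial>empirical Z)"
    by (rule integral_fst'[symmetric]) (rule integrable_pair_sphere_prob[OF e e k B])
  also have "\<dots> = (\<Sum>y\<in>Z. \<integral>z. k (y, z) \<partial>empirical Z) / card Z"
    using e.borel_measurable_lebesgue_integral[of "\<lambda>y z. k (y, z)" borel] k'
    by (intro integral_empirical Z) simp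
  also have "\<dots> = (\<Sum>y\<in>Z. (\<Sum>z\<in>Z. k (y, z)) / card Z) / card Z"
  proof -
    have "(\<integral>z. k (y, z) \<partial>empirical Z) = (\<Sum>z\<in>Z. k (y, z)) / card Z" for y
      using measurable_Pair2[OF k, of y] by (intro integral_empirical Z) simp
    then show ?thesis by simp
  qed
  finally show ?thesis by (simp add: sum_divide_distrib power2_eq_square)
qed

text \<open>The bound on Gaussian averages is uniform in the centre, so one \<open>C\<close> serves
  for all \<alpha>, in particular for all point sets.\<close>

lemma integral_pair_gauss_kernel_le:
  obtains C :: real where "C > 0"
    "\<And>s (\<alpha>::(real^'n) measure). s > 0 \<Longrightarrow> sphere_prob \<alpha> \<Longrightarrow>
       (\<integral>p. gauss_kernel s p \<partial>(\<alpha> \<Otimes>\<^sub>M sphere_measure)) \<le> C * s ^ (CARD('n) - 1)"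
proof -
  obtain C :: real where C: "C > 0"
    "\<And>s y::real^'n. s > 0 \<Longrightarrow> norm y = 1 \<Longrightarrow>
       (\<integral>z. exp (- (norm (y - z))\<^sup>2 / s\<^sup>2) \<partial>sphere_measure) \<le> C * s ^ (CARD('n) - 1)"
    using integral_sphere_gaussian_le[where 'n='n] by blast
  have "(\<integral>p. gauss_kernel s p \<partial>(\<alpha> \<Otimes>\<^sub>M sphere_measure)) \<le> C * s ^ (CARD('n) - 1)"
    if s: "s > 0" and a: "sphere_prob \<alpha>" for s and \<alpha> :: "(real^'n) measure"
  proof -
    interpret a: prob_space \<alpha> by (rule sphere_probD(1)[OF a])
    interpret b: prob_space "sphere_measure :: (real^'n) measure" by (rule prob_space_sphere_measure)
    interpret pair_prob_space \<alpha> "sphere_measure :: (real^'n) measure" ..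
    have int: "integrable (\<alpha> \<Otimes>\<^sub>M sphere_measure) (gauss_kernel s :: (real^'n) \<times> (real^'n) \<Rightarrow> real)"
      by (rule integrable_pair_sphere_prob[OF a sphere_prob_sphere_measure, of _ 1]) (auto simp: gauss_kernel_def)
    then have "(\<integral>p. gauss_kernel s p \<partial>(\<alpha> \<Otimes>\<^sub>M sphere_measure)) = (\<integral>y. \<integral>z. gauss_kernel s (y, z) \<partial>sphere_measure \<partial>\<alpha>)"
      by (rule integral_fst'[symmetric])
    also have "\<dots> \<le> (\<integral>y. C * s ^ (CARD('n) - 1) \<partial>\<alpha>)"
    proof (rule integral_mono_AE)
      show "AE y in \<alpha>. (\<integral>z. gauss_kernel s (y, z) \<partial>sphere_measure) \<le> C * s ^ (CARD('n) - 1)"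
        using sphere_probD(3)[OF a] by eventually_elim (use C(2)[OF s] in \<open>simp add: gauss_kernel_def\<close>)
    qed (use integrable_fst'[OF int] in auto)
    finally show ?thesis by (simp add: a.prob_space)
  qed
  with C(1) show ?thesis using that by blast
qed

section \<open>The distance as a superposition of Gaussians\<close>

text \<open>The substitution of \<open>r * s\<close> for \<open>s\<close> shows that the integral is
  linear in \<open>r\<close>. It is finite for \<open>r = 1\<close>, since the integrand is at most
  1 near 0 and at most 1/s^2 for large \<open>s\<close>.\<close>

lemma nn_integral_gauss_deficit:
  obtains \<kappa> :: real where "\<kappa> \<ge> 0"
    "\<And>r::real. r \<ge> 0 \<Longrightarrow> (\<integral>\<^sup>+s. ennreal (1 - exp (- r\<^sup>2 / s\<^sup>2)) * indicator {0<..} s \<partial>lborel) = ennreal (\<kappa> * r)"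
proof -
  define I where "I = (\<integral>\<^sup>+s. ennreal (1 - exp (- 1 / s\<^sup>2)) * indicator {0::real<..} s \<partial>lborel)"
  have "I \<le> (\<integral>\<^sup>+s. indicator {0..<1} s + ennreal (1 / s\<^sup>2) * indicator {1..} s \<partial>lborel)"
    unfolding I_def
  proof (rule nn_integral_mono)
    fix s :: real
    have "1 - exp (- 1 / s\<^sup>2) \<le> 1 / s\<^sup>2" using exp_ge_add_one_self[of "- 1 / s\<^sup>2"] by simp
    moreover have "1 - exp (- 1 / s\<^sup>2) \<le> 1" by simp
    ultimately show "ennreal (1 - exp (- 1 / s\<^sup>2)) * indicator {0<..} s \<le> indicator {0..<1} s + ennreal (1 / s\<^sup>2) * indicator {1..} s"
      by (auto simp: indicator_def ennreal_leI intro: order_trans[OF ennreal_leI])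
  qed
  also have "\<dots> = 1 + (\<integral>\<^sup>+s. ennreal (1 / s\<^sup>2) * indicator {1..} s \<partial>lborel)"
    by (subst nn_integral_add) simp_all
  also have "(\<integral>\<^sup>+s. ennreal (1 / s\<^sup>2) * indicator {1..} s \<partial>lborel) = ennreal 1"
  proof -
    have "((\<lambda>x::real. - 1 / x) \<longlongrightarrow> 0) at_top" by real_asymp
    moreover have "((\<lambda>x. - 1 / x) has_real_derivative 1 / x\<^sup>2) (at x)" if "1 \<le> x" for x :: real
      using that by (auto intro!: derivative_eq_intros simp: power2_eq_square)
    ultimately show ?thesis
      using nn_integral_FTC_atLeast[of "\<lambda>s. 1 / s\<^sup>2" 1 "\<lambda>s. - 1 / s" 0] by simp
  qed
  finally have "I < \<top>" by (auto simp: le_less_trans)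
  then obtain \<kappa> where \<kappa>: "\<kappa> \<ge> 0" "I = ennreal \<kappa>" by (cases I) auto
  have "(\<integral>\<^sup>+s. ennreal (1 - exp (- r\<^sup>2 / s\<^sup>2)) * indicator {0<..} s \<partial>lborel) = ennreal (\<kappa> * r)" if r: "r \<ge> 0" for r :: real
  proof (cases "r = 0")
    case False
    with r have "r > 0" by simp
    then have "(\<integral>\<^sup>+s. ennreal (1 - exp (- r\<^sup>2 / s\<^sup>2)) * indicator {0<..} s \<partial>lborel)
      = ennreal \<bar>r\<bar> * (\<integral>\<^sup>+s. ennreal (1 - exp (- r\<^sup>2 / (0 + r * s)\<^sup>2)) * indicator {0<..} (0 + r * s) \<partial>lborel)"
      by (intro nn_integral_real_affine) auto
    also have "(\<integral>\<^sup>+s. ennreal (1 - exp (- r\<^sup>2 / (0 + r * s)\<^sup>2)) * indicator {0<..} (0 + r * s) \<partial>lborel) = I"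
      unfolding I_def using \<open>r > 0\<close>
      by (intro nn_integral_cong) (auto simp: indicator_def zero_less_mult_iff power_mult_distrib)
    finally show ?thesis using \<kappa> r by (simp add: ennreal_mult mult.commute)
  qed simp
  with \<kappa>(1) show ?thesis using that by blast
qed

subsection \<open>Stolarsky's identity\<close>

lemma has_integral_energy_gauss_kernel:
  fixes \<alpha> \<beta> :: "(real^'n) measure"
  assumes \<kappa>: "\<kappa> \<ge> 0"
    "\<And>r::real. r \<ge> 0 \<Longrightarrow> (\<integral>\<^sup>+s. ennreal (1 - exp (- r\<^sup>2 / s\<^sup>2)) * indicator {0<..} s \<partial>lborel) = ennreal (\<kappa> * r)"
    and a: "sphere_prob \<alpha>" and b: "sphere_prob \<beta>"
  shows "has_bochner_integral lborel (\<lambda>s. indicator {0<..} s * energy (gauss_kernel s) \<alpha> \<beta>)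
    (- \<kappa> * energy (\<lambda>p. norm (fst p - snd p)) \<alpha> \<beta>)"
proof -
  \<comment> \<open>The double integral of the Gaussian kernel tends to 1 as \<open>s\<close> grows,
    so only its difference from 1 can be integrated over all scales.\<close>
  have deficit: "has_bochner_integral lborel (\<lambda>s. indicator {0<..} s * (1 - (\<integral>p. gauss_kernel s p \<partial>(\<mu> \<Otimes>\<^sub>M \<nu>))))
      (\<kappa> * (\<integral>p. norm (fst p - snd p) \<partial>(\<mu> \<Otimes>\<^sub>M \<nu>)))"
    if m: "sphere_prob \<mu>" and n: "sphere_prob \<nu>" for \<mu> \<nu> :: "(real^'n) measure"
  proof -
    let ?P = "\<mu> \<Otimes>\<^sub>M \<nu>"
    interpret P: prob_space ?P by (rule prob_space_pair_sphere_prob[OF m n])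
    interpret lP: pair_sigma_finite lborel ?P ..
    define f where "f s p = indicator {0<..} s * (1 - gauss_kernel s p)" for s :: real and p :: "(real^'n) \<times> (real^'n)"
    have [measurable_cong]: "sets ?P = sets (borel \<Otimes>\<^sub>M borel)" by (rule sets_pair_sphere_prob[OF m n])
    have f0: "0 \<le> f s p" "f s p \<le> 1" for s p
      by (auto simp: f_def gauss_kernel_def indicator_def)
    have [measurable]: "case_prod f \<in> borel_measurable (lborel \<Otimes>\<^sub>M ?P)"
      unfolding f_def gauss_kernel_def by measurable
    have int_gk: "integrable ?P (gauss_kernel s)" for s
      by (rule integrable_pair_sphere_prob[OF m n, of _ 1]) (auto simp: gauss_kernel_def)
    have int_f: "integrable ?P (f s)" for s
      unfolding f_def using int_gk by auto
    have eq: "(\<integral>p. f s p \<partial>?P) = indicator {0<..} s * (1 - (\<integral>p. gauss_kernel s p \<partial>?P))" for s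
      unfolding f_def using int_gk[of s] P.prob_space by (simp add: Bochner_Integration.integral_diff)
    have int_d: "integrable ?P (\<lambda>p. norm (fst p - snd p))"
      by (rule integrable_pair_norm_diff[OF m n])
    have "(\<integral>\<^sup>+s. ennreal (\<integral>p. f s p \<partial>?P) \<partial>lborel) = (\<integral>\<^sup>+s. \<integral>\<^sup>+p. ennreal (f s p) \<partial>?P \<partial>lborel)"
      by (intro nn_integral_cong) (subst nn_integral_eq_integral, auto simp: int_f f0)
    also have "\<dots> = (\<integral>\<^sup>+p. \<integral>\<^sup>+s. ennreal (f s p) \<partial>lborel \<partial>?P)"
      by (rule lP.Fubini'[symmetric]) (simp add: case_prod_beta)
    also have "\<dots> = (\<integral>\<^sup>+p. ennreal (\<kappa> * norm (fst p - snd p)) \<partial>?P)"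
    proof (rule nn_integral_cong)
      fix p :: "(real^'n) \<times> (real^'n)"
      have "(\<integral>\<^sup>+s. ennreal (f s p) \<partial>lborel)
        = (\<integral>\<^sup>+s. ennreal (1 - exp (- (norm (fst p - snd p))\<^sup>2 / s\<^sup>2)) * indicator {0<..} s \<partial>lborel)"
        by (intro nn_integral_cong) (auto simp: f_def gauss_kernel_def indicator_def)
      then show "(\<integral>\<^sup>+s. ennreal (f s p) \<partial>lborel) = ennreal (\<kappa> * norm (fst p - snd p))"
        using \<kappa>(2)[of "norm (fst p - snd p)"] by simp
    qed
    also have "\<dots> = ennreal (\<integral>p. \<kappa> * norm (fst p - snd p) \<partial>?P)"
      using int_d \<kappa>(1) by (intro nn_integral_eq_integral) auto
    finally have "has_bochner_integral lborel (\<lambda>s. \<integral>p. f s p \<partial>?P) (\<integral>p. \<kappa> * norm (fst p - snd p) \<partial>?P)"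
      using \<kappa>(1) by (intro has_bochner_integral_nn_integral) (auto simp: f0 intro!: integral_nonneg P.borel_measurable_lebesgue_integral)
    then show ?thesis by (simp add: eq)
  qed
  \<comment> \<open>The coefficients 1, -2, 1 of the energy sum to 0, so the constants 1 cancel and
    minus the deficits add up to the energy of the Gaussian kernel.\<close>
  have "has_bochner_integral lborel (\<lambda>s.
      - (indicator {0<..} s * (1 - (\<integral>p. gauss_kernel s p \<partial>(\<alpha> \<Otimes>\<^sub>M \<alpha>)))
         - 2 * (indicator {0<..} s * (1 - (\<integral>p. gauss_kernel s p \<partial>(\<alpha> \<Otimes>\<^sub>M \<beta>))))
         + indicator {0<..} s * (1 - (\<integral>p. gauss_kernel s p \<partial>(\<beta> \<Otimes>\<^sub>M \<beta>)))))
      (- (\<kappa> * (\<integral>p. norm (fst p - snd p) \<partial>(\<alpha> \<Otimes>\<^sub>M \<alpha>))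
         - 2 * (\<kappa> * (\<integral>p. norm (fst p - snd p) \<partial>(\<alpha> \<Otimes>\<^sub>M \<beta>)))
         + \<kappa> * (\<integral>p. norm (fst p - snd p) \<partial>(\<beta> \<Otimes>\<^sub>M \<beta>))))"
    by (intro has_bochner_integral_minus has_bochner_integral_add has_bochner_integral_diff
        has_bochner_integral_mult_right deficit a b)
  then show ?thesis
    by (simp add: energy_def algebra_simps)
qed

text \<open>For fixed \<open>x\<close>, two cap indicators overlap for \<tau> in an interval of
  length 1 + min(x.y, x.z). Writing the minimum as half of the sum minus the absolute difference and
  averaging over \<open>x\<close> kills the linear terms. What remains is the kernel 1 - (c/2)|y -
  z|, and the 1 cancels in the energy.\<close>

lemma stolarsky:
  fixes Z :: "(real^'n) set"
  assumes Z: "finite Z" "Z \<noteq> {}" "Z \<subseteq> sphere 0 1"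
    and c: "\<And>v::real^'n. (\<integral>x. \<bar>x \<bullet> v\<bar> \<partial>sphere_measure) = c * norm v"
  shows "cap_discrepancy_sq Z = - (c / 2) * energy (\<lambda>p. norm (fst p - snd p)) (empirical Z) sphere_measure"
proof -
  let ?\<sigma> = "sphere_measure :: (real^'n) measure"
  let ?\<nu> = "empirical Z"
  interpret \<sigma>: prob_space ?\<sigma> by (rule prob_space_sphere_measure)
  interpret l\<sigma>: pair_sigma_finite lborel ?\<sigma> ..
  note \<nu> = sphere_prob_empirical[OF Z]
  \<comment> \<open>The parameter \<open>u\<close> is a pair of height and centre. The range of
    heights is built into \<phi>, so the integral can run over all of \<open>lborel\<close>.\<close>
  define \<phi> :: "real \<times> (real^'n) \<Rightarrow> real^'n \<Rightarrow> real"
    where "\<phi> u y = (if -1 \<le> fst u \<and> fst u \<le> 1 \<and> fst u \<le> snd u \<bullet> y then 1 else 0)" for u y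
  define k where "k p = 1 - (c / 2) * norm (fst p - snd p)" for p :: "(real^'n) \<times> (real^'n)"
  have c0: "c \<ge> 0"
  proof -
    have "0 \<le> (\<integral>x. \<bar>x \<bullet> axis undefined 1\<bar> \<partial>?\<sigma>)" by simp
    then show ?thesis by (simp add: c)
  qed
  have cap_le: "\<bar>x \<bullet> y\<bar> \<le> 1" if "norm x = 1" "norm y = 1" for x y :: "real^'n"
    using Cauchy_Schwarz_ineq2[of x y] that by simp
  have intmin: "(\<integral>\<^sup>+x. ennreal (1 + min (x \<bullet> y) (x \<bullet> z)) \<partial>?\<sigma>) = ennreal (k (y, z))" and k0: "0 \<le> k (y, z)"
    if y: "norm y = 1" and z: "norm z = 1" for y z :: "real^'n"
  proof -
    have i: "integrable ?\<sigma> (\<lambda>x. x \<bullet> y)" "integrable ?\<sigma> (\<lambda>x. x \<bullet> z)" "integrable ?\<sigma> (\<lambda>x. \<bar>x \<bullet> (y - z)\<bar>)"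
    proof -
      have "\<bar>x \<bullet> (y - z)\<bar> \<le> norm (y - z)" if "norm x = 1" for x
        using Cauchy_Schwarz_ineq2[of x "y - z"] that by simp
      then show "integrable ?\<sigma> (\<lambda>x. x \<bullet> y)" "integrable ?\<sigma> (\<lambda>x. x \<bullet> z)" "integrable ?\<sigma> (\<lambda>x. \<bar>x \<bullet> (y - z)\<bar>)"
        using y z cap_le by (intro integrable_sphere_measure; auto)+
    qed
    have "min (x \<bullet> y) (x \<bullet> z) = (x \<bullet> y + x \<bullet> z - \<bar>x \<bullet> (y - z)\<bar>) / 2" for x
      by (auto simp: inner_diff_right min_def)
    then have m: "1 + min (x \<bullet> y) (x \<bullet> z) = 1 + (x \<bullet> y + x \<bullet> z - \<bar>x \<bullet> (y - z)\<bar>) / 2" for x by simp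
    have nn: "AE x in ?\<sigma>. 0 \<le> 1 + min (x \<bullet> y) (x \<bullet> z)"
      using AE_sphere_measure by eventually_elim (use cap_le[OF _ y] cap_le[OF _ z] in \<open>force simp: abs_le_iff\<close>)
    have im: "integrable ?\<sigma> (\<lambda>x. 1 + min (x \<bullet> y) (x \<bullet> z))"
      unfolding m using i by auto
    have "(\<integral>x. 1 + min (x \<bullet> y) (x \<bullet> z) \<partial>?\<sigma>) = k (y, z)"
      unfolding m using i \<sigma>.prob_space
      by (simp add: k_def c integral_sphere_measure_inner)
    then show "(\<integral>\<^sup>+x. ennreal (1 + min (x \<bullet> y) (x \<bullet> z)) \<partial>?\<sigma>) = ennreal (k (y, z))" "0 \<le> k (y, z)"
      using nn_integral_eq_integral[OF im nn] integral_nonneg_AE[OF nn] by simp_all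
  qed
  have \<phi>m [measurable]: "case_prod \<phi> \<in> borel_measurable ((lborel \<Otimes>\<^sub>M ?\<sigma>) \<Otimes>\<^sub>M borel)"
    unfolding \<phi>_def by measurable
  have main: "has_bochner_integral (lborel \<Otimes>\<^sub>M ?\<sigma>) (\<lambda>u. ((\<integral>y. \<phi> u y \<partial>?\<nu>) - (\<integral>y. \<phi> u y \<partial>?\<sigma>))\<^sup>2) (energy k ?\<nu> ?\<sigma>)"
  proof (rule square_diff_averages[OF _ \<nu> sphere_prob_sphere_measure \<phi>m])
    show "sigma_finite_measure (lborel \<Otimes>\<^sub>M ?\<sigma>)" by (rule sigma_finite_pair_measure) (auto intro: sigma_finite_lborel \<sigma>.sigma_finite_measure_axioms)
    show "0 \<le> \<phi> u y" "\<phi> u y \<le> 1" for u y by (auto simp: \<phi>_def)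
    show "k \<in> borel_measurable (borel \<Otimes>\<^sub>M borel)" unfolding k_def by measurable
    fix y z :: "real^'n" assume y: "norm y = 1" and z: "norm z = 1"
    show "0 \<le> k (y, z) \<and> k (y, z) \<le> 1" using k0[OF y z] c0 by (simp add: k_def)
    have "(\<integral>\<^sup>+u. ennreal (\<phi> u y * \<phi> u z) \<partial>(lborel \<Otimes>\<^sub>M ?\<sigma>)) = (\<integral>\<^sup>+x. \<integral>\<^sup>+\<tau>. ennreal (\<phi> (\<tau>, x) y * \<phi> (\<tau>, x) z) \<partial>lborel \<partial>?\<sigma>)"
      by (rule l\<sigma>.nn_integral_snd[symmetric]) (simp add: \<phi>_def)
    also have "\<dots> = (\<integral>\<^sup>+x. ennreal (1 + min (x \<bullet> y) (x \<bullet> z)) \<partial>?\<sigma>)"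
    proof (rule nn_integral_cong_AE)
      show "AE x in ?\<sigma>. (\<integral>\<^sup>+\<tau>. ennreal (\<phi> (\<tau>, x) y * \<phi> (\<tau>, x) z) \<partial>lborel) = ennreal (1 + min (x \<bullet> y) (x \<bullet> z))"
        using AE_sphere_measure
      proof eventually_elim
        case (elim x)
        then have "norm x = 1" by simp
        then have b: "\<bar>x \<bullet> y\<bar> \<le> 1" "\<bar>x \<bullet> z\<bar> \<le> 1" using cap_le y z by auto
        have "(\<integral>\<^sup>+\<tau>. ennreal (\<phi> (\<tau>, x) y * \<phi> (\<tau>, x) z) \<partial>lborel) = (\<integral>\<^sup>+\<tau>. indicator {-1..min (x \<bullet> y) (x \<bullet> z)} \<tau> \<partial>lborel)"
          using b by (intro nn_integral_cong) (auto simp: \<phi>_def indicator_def)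
        then show ?case using b by (simp add: min_def)
      qed
    qed
    finally show "(\<integral>\<^sup>+u. ennreal (\<phi> u y * \<phi> u z) \<partial>(lborel \<Otimes>\<^sub>M ?\<sigma>)) = ennreal (k (y, z))"
      using intmin[OF y z] by simp
  qed
  have av\<nu>: "(\<integral>y. \<phi> (\<tau>, x) y \<partial>?\<nu>) = real (card {z \<in> Z. z \<in> spherical_cap x \<tau>}) / real (card Z)"
    if "\<tau> \<in> {-1..1}" for \<tau> x
  proof -
    have "(\<integral>y. \<phi> (\<tau>, x) y \<partial>?\<nu>) = (\<Sum>z\<in>Z. \<phi> (\<tau>, x) z) / card Z"
      by (rule integral_empirical[OF Z(1,2)]) (simp add: \<phi>_def)
    also have "(\<Sum>z\<in>Z. \<phi> (\<tau>, x) z) = (\<Sum>z\<in>Z. if z \<in> spherical_cap x \<tau> then 1 else 0)"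
      using that Z(3) by (intro sum.cong) (auto simp: \<phi>_def spherical_cap_def)
    also have "\<dots> = real (card {z \<in> Z. z \<in> spherical_cap x \<tau>})"
      using Z(1) by (simp add: sum.If_cases Int_def)
    finally show ?thesis .
  qed
  have av\<sigma>: "(\<integral>y. \<phi> (\<tau>, x) y \<partial>?\<sigma>) = measure ?\<sigma> (spherical_cap x \<tau>)"
    if "\<tau> \<in> {-1..1}" for \<tau> x
  proof -
    have "spherical_cap x \<tau> = sphere 0 1 \<inter> {y. \<tau> \<le> x \<bullet> y}" by (auto simp: spherical_cap_def)
    then have "closed (spherical_cap x \<tau>)"
      by (auto intro!: closed_Int closed_halfspace_ge)
    then have [measurable]: "spherical_cap x \<tau> \<in> sets borel" by simp
    have "(\<integral>y. \<phi> (\<tau>, x) y \<partial>?\<sigma>) = (\<integral>y. indicator (spherical_cap x \<tau>) y \<partial>?\<sigma>)"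
    proof (rule integral_cong_AE)
      \<comment> \<open>Off the sphere \<phi> describes a half-space instead of a cap, hence
        equality only almost everywhere.\<close>
      show "AE y in ?\<sigma>. \<phi> (\<tau>, x) y = indicator (spherical_cap x \<tau>) y"
        using AE_sphere_measure by eventually_elim (use that in \<open>auto simp: \<phi>_def spherical_cap_def indicator_def\<close>)
    qed (simp_all add: \<phi>_def)
    then show ?thesis by simp
  qed
  let ?D = "\<lambda>\<tau> x. \<bar>real (card {z \<in> Z. z \<in> spherical_cap x \<tau>}) / real (card Z) - measure ?\<sigma> (spherical_cap x \<tau>)\<bar>\<^sup>2"
  have "cap_discrepancy_sq Z = (\<integral>\<tau>. \<integral>x. ((\<integral>y. \<phi> (\<tau>, x) y \<partial>?\<nu>) - (\<integral>y. \<phi> (\<tau>, x) y \<partial>?\<sigma>))\<^sup>2 \<partial>?\<sigma> \<partial>lborel)"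
    unfolding cap_discrepancy_sq_def set_lebesgue_integral_def
  proof (rule Bochner_Integration.integral_cong)
    fix \<tau> :: real
    show "indicator {- 1..1} \<tau> *\<^sub>R (\<integral>x. ?D \<tau> x \<partial>?\<sigma>) = (\<integral>x. ((\<integral>y. \<phi> (\<tau>, x) y \<partial>?\<nu>) - (\<integral>y. \<phi> (\<tau>, x) y \<partial>?\<sigma>))\<^sup>2 \<partial>?\<sigma>)"
    proof (cases "\<tau> \<in> {-1..1}")
      case True
      then show ?thesis by (simp add: av\<nu>[OF True] av\<sigma>[OF True])
    next
      case False
      then have "\<phi> (\<tau>, x) y = 0" for x y by (auto simp: \<phi>_def)
      with False show ?thesis by simp
    qed
  qed simp
  \<comment> \<open>\<open>main\<close> also supplies the integrability that permits passing from
    the iterated integral to the product measure.\<close>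
  also have "\<dots> = energy k ?\<nu> ?\<sigma>"
    using l\<sigma>.integral_fst'[of "\<lambda>u. ((\<integral>y. \<phi> u y \<partial>?\<nu>) - (\<integral>y. \<phi> u y \<partial>?\<sigma>))\<^sup>2"] main
    by (simp add: has_bochner_integral_iff)
  also have "\<dots> = - (c / 2) * energy (\<lambda>p. norm (fst p - snd p)) ?\<nu> ?\<sigma>"
  proof -
    have "(\<integral>p. k p \<partial>(\<mu> \<Otimes>\<^sub>M \<mu>')) = 1 - (c / 2) * (\<integral>p. norm (fst p - snd p) \<partial>(\<mu> \<Otimes>\<^sub>M \<mu>'))"
      if m: "sphere_prob \<mu>" and n: "sphere_prob \<mu>'" for \<mu> \<mu>' :: "(real^'n) measure"
    proof -
      interpret P: prob_space "\<mu> \<Otimes>\<^sub>M \<mu>'" by (rule prob_space_pair_sphere_prob[OF m n])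
      have int_d: "integrable (\<mu> \<Otimes>\<^sub>M \<mu>') (\<lambda>p. norm (fst p - snd p))"
        by (rule integrable_pair_norm_diff[OF m n])
      then show ?thesis
        unfolding k_def using P.prob_space by (simp add: Bochner_Integration.integral_diff)
    qed
    from this[OF \<nu> \<nu>] this[OF \<nu> sphere_prob_sphere_measure] this[OF sphere_prob_sphere_measure sphere_prob_sphere_measure]
    show ?thesis by (simp add: energy_def algebra_simps)
  qed
  finally show ?thesis .
qed

subsection \<open>The lower bound\<close>

text \<open>With the exponent written as \<open>q + 1\<close>, the weight has total mass
  \<open>s0 / q\<close>, and its Gaussian integrals are bounded below by a multiple of the power
  \<open>- q\<close> of 1 + r/s0.\<close>

definition scale_weight :: "real \<Rightarrow> real \<Rightarrow> real \<Rightarrow> real" where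
  "scale_weight s0 q s = indicator {s0..} s * (s0 / s) powr (q + 1)"

lemma scale_weight_measurable [measurable]: "scale_weight s0 q \<in> borel_measurable borel"
  unfolding scale_weight_def by measurable

lemma scale_weight_bounds:
  assumes "s0 > 0" "q > 0"
  shows "0 \<le> scale_weight s0 q s" "scale_weight s0 q s \<le> 1"
  using assms
  by (auto simp: scale_weight_def indicator_def intro!: powr_le1)

lemma has_integral_powr_tail:
  fixes e a :: real
  assumes e: "e < -1" and a: "a > 0"
  shows "has_bochner_integral lborel (\<lambda>s. indicator {a..} s * s powr e) (a powr (e + 1) / (- e - 1))"
proof -
  have "(\<integral>\<^sup>+s. ennreal (s powr e) * indicator {a..} s \<partial>lborel) = ennreal (0 - a powr (e + 1) / (e + 1))"
  proof (rule nn_integral_FTC_atLeast)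
    show "((\<lambda>s. s powr (e + 1) / (e + 1)) \<longlongrightarrow> 0) at_top"
      using e by real_asymp
    show "((\<lambda>s. s powr (e + 1) / (e + 1)) has_real_derivative s powr e) (at s)" if "a \<le> s" for s
      using that a e by (auto intro!: derivative_eq_intros)
  qed auto
  also have "(\<lambda>s. ennreal (s powr e) * indicator {a..} s) = (\<lambda>s. ennreal (indicator {a..} s * s powr e))"
    by (auto simp: indicator_def)
  also have "0 - a powr (e + 1) / (e + 1) = a powr (e + 1) / (- e - 1)"
    using e by (simp add: field_simps)
  finally have "(\<integral>\<^sup>+s. ennreal (indicator {a..} s * s powr e) \<partial>lborel) = ennreal (a powr (e + 1) / (- e - 1))" .
  then show ?thesis
    using e by (intro has_bochner_integral_nn_integral) auto
qed

text \<open>\<open>b < q\<close> says that the tail exponent \<open>b - q - 1\<close> is below -1.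
  The case b = d measures the contribution of the surface measure, and b = 0 gives the mass of the
  weight.\<close>

lemma has_integral_scale_weight_powr:
  assumes s0: "s0 > 0" and b: "b < q"
  shows "has_bochner_integral lborel (\<lambda>s. scale_weight s0 q s * s powr b) (s0 powr (b + 1) / (q - b))"
proof -
  have "has_bochner_integral lborel (\<lambda>s. s0 powr (q + 1) * (indicator {s0..} s * s powr (b - q - 1)))
      (s0 powr (q + 1) * (s0 powr (b - q - 1 + 1) / (- (b - q - 1) - 1)))"
    by (rule has_bochner_integral_mult_right, rule has_integral_powr_tail) (use b s0 in auto)
  moreover have "s0 powr (q + 1) * (indicator {s0..} s * s powr (b - q - 1)) = scale_weight s0 q s * s powr b" for s
    using s0 by (auto simp: scale_weight_def indicator_def powr_divide powr_diff powr_add field_simps)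
  moreover have "s0 powr (q + 1) * (s0 powr (b - q - 1 + 1) / (- (b - q - 1) - 1)) = s0 powr (b + 1) / (q - b)"
    by (simp add: powr_add[symmetric] add.commute)
  ultimately show ?thesis by (simp only:)
qed

lemma integral_scale_weight:
  assumes s0: "s0 > 0" and q: "q > 0"
  shows "has_bochner_integral lborel (scale_weight s0 q) (s0 / q)"
proof -
  \<comment> \<open>\<open>0 powr 0\<close> is 0, but the weight already vanishes there because
    \<open>s0 > 0\<close>.\<close>
  have "(\<lambda>s. scale_weight s0 q s * s powr 0) = scale_weight s0 q"
    using s0 by (auto simp: scale_weight_def indicator_def)
  then show ?thesis using has_integral_scale_weight_powr[OF s0 q] s0 by (simp del: powr_0)
qed

lemma integrable_scale_weight_gauss:
  assumes s0: "s0 > 0" and q: "q > 0"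
  shows "integrable lborel (\<lambda>s. scale_weight s0 q s * exp (- r\<^sup>2 / s\<^sup>2))"
proof (rule Bochner_Integration.integrable_bound)
  show "integrable lborel (scale_weight s0 q)"
    using integral_scale_weight[OF assms] by (simp add: has_bochner_integral_iff)
  show "AE s in lborel. norm (scale_weight s0 q s * exp (- r\<^sup>2 / s\<^sup>2)) \<le> norm (scale_weight s0 q s)"
    using scale_weight_bounds[OF assms] by (auto simp: abs_mult mult_left_le)
qed measurable

text \<open>Only scales \<open>s \<ge> s0 + r\<close> are kept: there the Gaussian is at least
  \<open>exp (-1)\<close>, and the tail of the weight has an explicit integral.\<close>

lemma integral_scale_weight_gauss_ge:
  assumes s0: "s0 > 0" and q: "q > 0" and r: "r \<ge> 0"
  shows "exp (-1) / q * s0 * (1 + r / s0) powr (- q) \<le> (\<integral>s. scale_weight s0 q s * exp (- r\<^sup>2 / s\<^sup>2) \<partial>lborel)"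
proof -
  have *: "has_bochner_integral lborel (\<lambda>s. exp (-1) * s0 powr (q + 1) * (indicator {s0 + r..} s * s powr (- q - 1)))
     (exp (-1) * s0 powr (q + 1) * ((s0 + r) powr (- q - 1 + 1) / (- (- q - 1) - 1)))"
    by (rule has_bochner_integral_mult_right, rule has_integral_powr_tail) (use assms in auto)
  have "exp (-1) / q * s0 * (1 + r / s0) powr (- q) = exp (-1) * s0 powr (q + 1) * ((s0 + r) powr (- q - 1 + 1) / (- (- q - 1) - 1))"
  proof -
    have "1 + r / s0 = (s0 + r) / s0" using s0 by (simp add: field_simps)
    then have "(1 + r / s0) powr (- q) = (s0 + r) powr (- q) * s0 powr q"
      using s0 r by (simp add: powr_divide powr_minus field_simps)
    then show ?thesis using s0 by (simp add: powr_add)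
  qed
  also have "\<dots> = (\<integral>s. exp (-1) * s0 powr (q + 1) * (indicator {s0 + r..} s * s powr (- q - 1)) \<partial>lborel)"
    using has_bochner_integral_integral_eq[OF *] by simp
  also have "\<dots> \<le> (\<integral>s. scale_weight s0 q s * exp (- r\<^sup>2 / s\<^sup>2) \<partial>lborel)"
  proof (rule integral_mono)
    fix s :: real
    show "exp (-1) * s0 powr (q + 1) * (indicator {s0 + r..} s * s powr (- q - 1)) \<le> scale_weight s0 q s * exp (- r\<^sup>2 / s\<^sup>2)"
    proof (cases "s \<ge> s0 + r")
      case True
      then have s: "s > 0" "s \<ge> r" "s \<ge> s0" using s0 r by auto
      have "r\<^sup>2 \<le> s\<^sup>2" using s r by (intro power_mono) auto
      then have "exp (-1) \<le> exp (- r\<^sup>2 / s\<^sup>2)" using s by simp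
      then have "(s0 / s) powr (q + 1) * exp (-1) \<le> (s0 / s) powr (q + 1) * exp (- r\<^sup>2 / s\<^sup>2)"
        by (rule mult_left_mono) simp
      moreover have "(s0 / s) powr (q + 1) = s0 powr (q + 1) * s powr (- q - 1)"
        using s s0 powr_minus[of s "q + 1"] by (simp add: powr_divide[of s0 s]) (simp add: divide_inverse)
      ultimately show ?thesis using s True by (simp add: scale_weight_def mult_ac)
    qed (use scale_weight_bounds[OF s0 q, of s] in simp)
  qed (use * integrable_scale_weight_gauss[OF s0 q] in \<open>auto simp: has_bochner_integral_iff\<close>)
  finally show ?thesis .
qed

text \<open>The logarithm costs at most half a power: ln t \<le> t at t = sqrt (2 + R), with 2 + R
  \<le> 4 (1 + R), gives ln (2 + R) \<le> 4 sqrt (1 + R).\<close>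

lemma ln_two_plus_le:
  fixes R :: real
  assumes "R \<ge> 0"
  shows "ln (2 + R) / (1 + R) powr (q + 1/2) \<le> 4 * (1 + R) powr (- q)"
proof -
  have "ln (2 + R) = 2 * ln (sqrt (2 + R))" using assms by (simp add: ln_sqrt)
  also have "\<dots> \<le> 2 * sqrt (2 + R)" using ln_bound[of "sqrt (2 + R)"] assms by simp
  also have "\<dots> \<le> 2 * sqrt (4 * (1 + R))" using assms by (intro mult_left_mono real_sqrt_le_mono) auto
  also have "\<dots> = 4 * (1 + R) powr (1/2)"
    unfolding real_sqrt_mult using assms by (simp add: powr_half_sqrt)
  finally have "ln (2 + R) / (1 + R) powr (q + 1/2) \<le> 4 * (1 + R) powr (1/2) / (1 + R) powr (q + 1/2)"
    by (rule divide_right_mono) simp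
  also have "\<dots> = 4 * (1 + R) powr (1/2 - (q + 1/2))"
    by (simp only: powr_diff times_divide_eq_right)
  also have "1/2 - (q + 1/2) = - q" by simp
  finally show ?thesis .
qed

section \<open>Weighted energies and the choice of constants\<close>

text \<open>A weight with values in [0,1] can only lower the integral of the nonnegative energies.
  In the weighted energy the term with \<sigma> twice is dropped as nonnegative, and the mixed term
  is bounded by \<open>C\<close>. The factor 4 is the 2 of the mixed term divided by q - d =
  1/2.\<close>

lemma pair_energy_bound:
  fixes Z :: "(real^'n) set"
  assumes Z: "finite Z" "Z \<noteq> {}" "Z \<subseteq> sphere 0 1"
    and s0: "s0 > 0" and n: "CARD('n) \<ge> 2" and q: "q = real (CARD('n) - 1) + 1/2"
    and I: "has_bochner_integral lborel (\<lambda>s. indicator {0<..} s * energy (gauss_kernel s) (empirical Z) sphere_measure) I"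
    and C: "\<And>s. s > 0 \<Longrightarrow>
       (\<integral>p. gauss_kernel s p \<partial>(empirical Z \<Otimes>\<^sub>M (sphere_measure :: (real^'n) measure))) \<le> C * s ^ (CARD('n) - 1)"
  shows "(\<Sum>y\<in>Z. \<Sum>z\<in>Z. \<integral>s. scale_weight s0 q s * exp (- (norm (y - z))\<^sup>2 / s\<^sup>2) \<partial>lborel) / (real (card Z))\<^sup>2
     - 4 * C * s0 powr (real (CARD('n) - 1) + 1) \<le> I"
proof -
  let ?\<sigma> = "sphere_measure :: (real^'n) measure"
  let ?d = "real (CARD('n) - 1)"
  have q0: "q > 0" unfolding q by (rule add_nonneg_pos) auto
  note \<nu> = sphere_prob_empirical[OF Z]
  define G where "G y z = (\<integral>s. scale_weight s0 q s * exp (- (norm (y - z))\<^sup>2 / s\<^sup>2) \<partial>lborel)" for y z :: "real^'n"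
  define f where "f s = (\<Sum>y\<in>Z. \<Sum>z\<in>Z. scale_weight s0 q s * exp (- (norm (y - z))\<^sup>2 / s\<^sup>2)) / (real (card Z))\<^sup>2
      - 2 * C * (scale_weight s0 q s * s powr ?d)" for s
  have f: "has_bochner_integral lborel f
      ((\<Sum>y\<in>Z. \<Sum>z\<in>Z. G y z) / (real (card Z))\<^sup>2 - 2 * C * (s0 powr (?d + 1) / (q - ?d)))"
    unfolding f_def G_def
    using integrable_scale_weight_gauss[OF s0 q0] q
    by (intro has_bochner_integral_diff has_bochner_integral_divide_zero has_bochner_integral_sum has_bochner_integral_mult_right
        has_integral_scale_weight_powr s0) (auto simp: has_bochner_integral_iff)
  \<comment> \<open>Below \<open>s0\<close> the weight, hence \<open>f\<close>, is 0 and
    nonnegativity of the energy suffices; from \<open>s0\<close> on, the estimates of the three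
    terms apply.\<close>
  have le: "f s \<le> indicator {0<..} s * energy (gauss_kernel s) (empirical Z) ?\<sigma>" for s
  proof (cases "s \<ge> s0")
    case True
    with s0 have s: "s > 0" by simp
    let ?E = "energy (gauss_kernel s) (empirical Z) ?\<sigma>"
    let ?A = "\<integral>p. gauss_kernel s p \<partial>(empirical Z \<Otimes>\<^sub>M empirical Z)"
    have A: "?A = (\<Sum>y\<in>Z. \<Sum>z\<in>Z. exp (- (norm (y - z))\<^sup>2 / s\<^sup>2)) / (real (card Z))\<^sup>2"
      by (subst integral_pair_empirical[OF Z, of _ 1]) (auto simp: gauss_kernel_def)
    have "(\<integral>p. gauss_kernel s p \<partial>(?\<sigma> \<Otimes>\<^sub>M ?\<sigma>)) \<ge> 0"
      by (intro Bochner_Integration.integral_nonneg) (auto simp: gauss_kernel_def)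
    then have E: "?A - 2 * C * s ^ (CARD('n) - 1) \<le> ?E"
      using C[OF s] by (simp add: energy_def)
    have "f s = scale_weight s0 q s * (?A - 2 * C * s ^ (CARD('n) - 1))"
      unfolding f_def A powr_realpow[OF s] by (simp add: sum_distrib_left right_diff_distrib mult_ac)
    also have "\<dots> \<le> scale_weight s0 q s * ?E"
      using E scale_weight_bounds(1)[OF s0 q0] by (rule mult_left_mono)
    also have "\<dots> \<le> 1 * ?E"
      using scale_weight_bounds[OF s0 q0] energy_gauss_kernel_nonneg[OF s \<nu> sphere_prob_sphere_measure]
      by (intro mult_right_mono) auto
    finally show ?thesis using s by simp
  next
    case False
    then have "f s = 0" by (simp add: f_def scale_weight_def)
    then show ?thesis
      using energy_gauss_kernel_nonneg[OF _ \<nu> sphere_prob_sphere_measure, of s] by (auto simp: indicator_def)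
  qed
  have "integral\<^sup>L lborel f \<le> (\<integral>s. indicator {0<..} s * energy (gauss_kernel s) (empirical Z) ?\<sigma> \<partial>lborel)"
    by (rule integral_mono[OF integrable.intros[OF f] integrable.intros[OF I] le])
  then have "(\<Sum>y\<in>Z. \<Sum>z\<in>Z. G y z) / (real (card Z))\<^sup>2 - 2 * C * (s0 powr (?d + 1) / (q - ?d)) \<le> I"
    by (simp only: has_bochner_integral_integral_eq[OF f] has_bochner_integral_integral_eq[OF I])
  then show ?thesis using q by (simp add: G_def)
qed

theorem theorem3:
  assumes "CARD('n) \<ge> 2"
  shows "\<exists>c>0. \<forall>Z :: (real^'n) set. finite Z \<and> Z \<noteq> {} \<and> Z \<subseteq> sphere 0 1 \<longrightarrow>
     (let N = real (card Z); d = real (CARD('n) - 1) in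
       cap_discrepancy Z \<ge> c * N powr (-1/2 - 1/(2*d)) *
         sqrt ((1/N) * (\<Sum>zi\<in>Z. \<Sum>zj\<in>Z.
            ln (2 + N powr (1/d) * norm (zi - zj)) /
            (1 + N powr (1/d) * norm (zi - zj)) ^ CARD('n))))"
proof -
  obtain c where c: "c > 0" "\<And>v::real^'n. (\<integral>x. \<bar>x \<bullet> v\<bar> \<partial>sphere_measure) = c * norm v"
    using integral_sphere_measure_abs_inner[where 'n='n] by blast
  obtain \<kappa> where \<kappa>: "\<kappa> \<ge> 0"
    "\<And>r::real. r \<ge> 0 \<Longrightarrow> (\<integral>\<^sup>+s. ennreal (1 - exp (- r\<^sup>2 / s\<^sup>2)) * indicator {0<..} s \<partial>lborel) = ennreal (\<kappa> * r)"
    using nn_integral_gauss_deficit by blast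
  obtain C where C: "C > 0" "\<And>s (\<alpha>::(real^'n) measure). s > 0 \<Longrightarrow> sphere_prob \<alpha> \<Longrightarrow>
       (\<integral>p. gauss_kernel s p \<partial>(\<alpha> \<Otimes>\<^sub>M sphere_measure)) \<le> C * s ^ (CARD('n) - 1)"
    using integral_pair_gauss_kernel_le[where 'n='n] by blast
  define d where "d = real (CARD('n) - 1)"
  \<comment> \<open>Strictly between d and d + 1: \<open>q > d\<close> makes s^d integrable against
    the weight, and \<open>q < d + 1\<close> leaves room for the logarithm.\<close>
  define q where "q = d + 1/2"
  have d1: "d \<ge> 1" and q0: "q > 0" using assms by (auto simp: d_def q_def)
  \<comment> \<open>Small enough for \<open>ad\<close>, which keeps the loss from \<sigma> below
    half of the diagonal; \<open>a \<le> 1\<close> is used to bound 1 + R/a by (1 + R)/a.\<close>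
  define a where "a = min 1 ((1 / (8 * C * q)) powr (1 / d))"
  have a: "0 < a" "a \<le> 1" using C q0 by (auto simp: a_def)
  have ad: "4 * C * a powr d \<le> 1 / (2 * q)"
  proof -
    have "a powr d \<le> ((1 / (8 * C * q)) powr (1 / d)) powr d"
      using a d1 by (intro powr_mono2) (auto simp: a_def)
    also have "\<dots> = 1 / (8 * C * q)" using d1 C q0 by (simp add: powr_powr)
    finally show ?thesis using C(1) q0 by (simp add: field_simps)
  qed
  \<comment> \<open>The 1/4 absorbs the factor 4 of \<open>ln_two_plus_le\<close>. One power of
    \<open>a\<close> comes from \<open>s0\<close>, and the other \<open>q\<close> come from
    measuring distances in units of N^(-1/d) instead of \<open>s0\<close>.\<close>
  define g where "g = exp (-1) / q * a powr (q + 1) / 4"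
  have g: "g > 0" using q0 a by (simp add: g_def)
  \<comment> \<open>Only \<kappa> \<ge> 0 is known; \<kappa> + 1 is a safe positive
    denominator.\<close>
  define m where "m = c * g / (4 * (\<kappa> + 1))"
  have m: "m > 0" using c(1) g \<kappa>(1) by (simp add: m_def)
  have "cap_discrepancy Z \<ge> sqrt m * real (card Z) powr (-1/2 - 1/(2*d)) *
         sqrt ((1/real (card Z)) * (\<Sum>zi\<in>Z. \<Sum>zj\<in>Z.
            ln (2 + real (card Z) powr (1/d) * norm (zi - zj)) /
            (1 + real (card Z) powr (1/d) * norm (zi - zj)) ^ CARD('n)))"
    if Z: "finite Z" "Z \<noteq> {}" "Z \<subseteq> sphere 0 1" for Z :: "(real^'n) set"
  proof -
    define N where "N = real (card Z)"
    have N: "N > 0" using Z by (simp add: N_def card_gt_0_iff)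
    define F where "F y z = ln (2 + N powr (1/d) * norm (y - z)) / (1 + N powr (1/d) * norm (y - z)) ^ CARD('n)"
      for y z :: "real^'n"
    define S where "S = (\<Sum>y\<in>Z. \<Sum>z\<in>Z. F y z)"
    define s0 where "s0 = a * N powr (- 1 / d)"
    have s0: "s0 > 0" using a N by (simp add: s0_def)
    define G where "G y z = (\<integral>s. scale_weight s0 q s * exp (- (norm (y - z))\<^sup>2 / s\<^sup>2) \<partial>lborel)" for y z :: "real^'n"
    define T where "T = (\<Sum>y\<in>Z. \<Sum>z\<in>Z. G y z)"
    let ?X = "cap_discrepancy_sq Z"
    have X0: "?X \<ge> 0"
      unfolding cap_discrepancy_sq_def set_lebesgue_integral_def by (intro Bochner_Integration.integral_nonneg) auto
    note \<nu> = sphere_prob_empirical[OF Z]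
    have G0: "G y z \<ge> 0" for y z
      unfolding G_def using scale_weight_bounds[OF s0 q0] by (intro Bochner_Integration.integral_nonneg) auto
    have GF: "g * N powr (- 1 / d) * F y z \<le> G y z" for y z
    proof -
      define R where "R = N powr (1/d) * norm (y - z)"
      have R: "R \<ge> 0" by (simp add: R_def)
      have "F y z = ln (2 + R) / (1 + R) powr (q + 1/2)"
      proof -
        \<comment> \<open>The dimension of the ambient space is d + 1, so the half power spent on
          the logarithm is exactly what separates \<open>q\<close> from the required
          exponent.\<close>
        have "q + 1/2 = real CARD('n)" using assms by (simp add: q_def d_def of_nat_diff)
        then show ?thesis using R by (simp add: F_def R_def[symmetric] powr_realpow)
      qed
      then have F4: "F y z \<le> 4 * (1 + R) powr (- q)" using ln_two_plus_le[OF R] by simp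
      have "norm (y - z) / s0 = R / a"
        using N a by (simp add: s0_def R_def powr_minus field_simps)
      then have le: "1 + norm (y - z) / s0 \<le> (1 + R) / a"
        using a by (simp add: add_divide_distrib)
      have "a powr q * (1 + R) powr (- q) = ((1 + R) / a) powr (- q)"
        using a R by (simp add: powr_divide powr_minus field_simps)
      also have "\<dots> \<le> (1 + norm (y - z) / s0) powr (- q)"
        using le s0 q0 by (intro powr_mono2') (auto simp: add_pos_nonneg)
      finally have le2: "a powr q * (1 + R) powr (- q) \<le> (1 + norm (y - z) / s0) powr (- q)" .
      have "g * N powr (- 1 / d) * F y z \<le> g * N powr (- 1 / d) * (4 * (1 + R) powr (- q))"
        using g F4 by (intro mult_left_mono) auto
      also have "\<dots> = exp (-1) / q * s0 * (a powr q * (1 + R) powr (- q))"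
        using a by (simp add: g_def s0_def powr_add)
      also have "\<dots> \<le> exp (-1) / q * s0 * (1 + norm (y - z) / s0) powr (- q)"
        using le2 q0 s0 by (intro mult_left_mono) auto
      also have "\<dots> \<le> G y z"
        unfolding G_def by (rule integral_scale_weight_gauss_ge) (use s0 q0 in auto)
      finally show ?thesis .
    qed
    \<comment> \<open>On the diagonal the Gaussian is 1, so each of the N points contributes the
      full mass \<open>s0 / q\<close> of the weight.\<close>
    have diag: "N * (s0 / q) \<le> T"
    proof -
      have "G y y = s0 / q" for y
        using has_bochner_integral_integral_eq[OF integral_scale_weight[OF s0 q0]] by (simp add: G_def)
      moreover have "G y y \<le> (\<Sum>z\<in>Z. G y z)" if "y \<in> Z" for y
        using Z(1) that G0 by (intro member_le_sum) auto
      ultimately have "(\<Sum>y\<in>Z. s0 / q) \<le> T"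
        unfolding T_def by (intro sum_mono) metis
      then show ?thesis by (simp add: N_def)
    qed
    \<comment> \<open>By the choice of \<open>s0\<close>, s0^(d+1) = s0 a^d / N has the same order
      in N as the diagonal part of T / N^2, which is s0 / (q N); \<open>ad\<close> makes it at most
      half of that.\<close>
    have mean: "4 * C * s0 powr (d + 1) \<le> T / N\<^sup>2 / 2"
    proof -
      have "s0 powr (d + 1) = s0 * (a powr d / N)"
      proof -
        have "s0 powr d = a powr d * N powr (- 1 / d * d)"
          unfolding s0_def using a N by (subst powr_mult) (auto simp: powr_powr)
        also have "- 1 / d * d = - 1" using d1 by simp
        finally show ?thesis using s0 N by (simp add: powr_add powr_minus divide_inverse)
      qed
      then have "4 * C * s0 powr (d + 1) = s0 / N * (4 * C * a powr d)" by simp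
      also have "\<dots> \<le> s0 / N * (1 / (2 * q))" using ad s0 N by (intro mult_left_mono) auto
      also have "\<dots> = N * (s0 / q) / N\<^sup>2 / 2" using N by (simp add: power2_eq_square)
      also have "\<dots> \<le> T / N\<^sup>2 / 2" using diag by (intro divide_right_mono) auto
      finally show ?thesis .
    qed
    have "T / N\<^sup>2 - 4 * C * s0 powr (d + 1) \<le> - \<kappa> * energy (\<lambda>p. norm (fst p - snd p)) (empirical Z) sphere_measure"
      unfolding T_def G_def N_def d_def
      by (rule pair_energy_bound[OF Z s0 assms _ has_integral_energy_gauss_kernel[OF \<kappa> \<nu> sphere_prob_sphere_measure] C(2)[OF _ \<nu>]])
         (auto simp: q_def d_def)
    also have "\<dots> = 2 * \<kappa> / c * ?X"
      using c(1) by (simp add: stolarsky[OF Z c(2)])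
    also have "\<dots> \<le> 2 * (\<kappa> + 1) / c * ?X"
      using c(1) X0 by (intro mult_right_mono divide_right_mono) auto
    finally have "T / N\<^sup>2 / 2 \<le> 2 * (\<kappa> + 1) / c * ?X" using mean by simp
    then have "c / (2 * (\<kappa> + 1)) * (T / N\<^sup>2 / 2) \<le> c / (2 * (\<kappa> + 1)) * (2 * (\<kappa> + 1) / c * ?X)"
      using c(1) \<kappa>(1) by (intro mult_left_mono) auto
    moreover have "c / (2 * (\<kappa> + 1)) * (2 * (\<kappa> + 1) / c * ?X) = ?X"
      using c(1) \<kappa>(1) by simp
    moreover have "c / (4 * (\<kappa> + 1)) * (T / N\<^sup>2) = c / (2 * (\<kappa> + 1)) * (T / N\<^sup>2 / 2)"
      by (simp add: field_simps)
    ultimately have "c / (4 * (\<kappa> + 1)) * (T / N\<^sup>2) \<le> ?X" by (simp only:)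
    moreover have "g * N powr (- 1 / d) * S \<le> T"
      unfolding S_def T_def sum_distrib_left by (intro sum_mono GF)
    then have "c / (4 * (\<kappa> + 1)) * (g * N powr (- 1 / d) * S / N\<^sup>2) \<le> c / (4 * (\<kappa> + 1)) * (T / N\<^sup>2)"
      using c(1) \<kappa>(1) by (intro mult_left_mono divide_right_mono) auto
    ultimately have "m * (N powr (- 1 / d) / N) * (1 / N * S) \<le> ?X"
      by (simp add: m_def power2_eq_square mult_ac)
    \<comment> \<open>Of the two factors 1/N in T / N^2, one stays with the double sum. The other
      joins N^(-1/d) to form the square of the power in the claim.\<close>
    moreover have "N powr (- 1 / d) / N = N powr (-1/2 - 1/(2*d)) * N powr (-1/2 - 1/(2*d))"
    proof -
      have "(-1/2 - 1/(2*d)) + (-1/2 - 1/(2*d)) = - 1 / d - 1" using d1 by (simp add: field_simps)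
      then have "N powr (-1/2 - 1/(2*d)) * N powr (-1/2 - 1/(2*d)) = N powr (- 1 / d - 1)"
        by (simp only: powr_add[symmetric])
      then show ?thesis using N by (simp add: powr_diff)
    qed
    ultimately have "sqrt (m * (N powr (-1/2 - 1/(2*d)))\<^sup>2 * (1 / N * S)) \<le> sqrt ?X"
      by (simp only: power2_eq_square real_sqrt_le_iff)
    moreover have "sqrt (m * (N powr (-1/2 - 1/(2*d)))\<^sup>2 * (1 / N * S)) = sqrt m * N powr (-1/2 - 1/(2*d)) * sqrt (1 / N * S)"
      unfolding real_sqrt_mult real_sqrt_abs by simp
    ultimately show ?thesis
      unfolding cap_discrepancy_def S_def F_def N_def by (simp only:)
  qed
  then show ?thesis
    using m by (intro exI[of _ "sqrt m"]) (simp add: Let_def d_def)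
qed

end
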